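(* Let $X$ be a super-reflexive Banach space, $U\subset X$ an open quasiconvex set, and $f\in C^{1,+}(U)$. Then $f$ can be extended to a function $F\in C^{1,+}_{\mathrm B}(X)$.
   Context: All normed linear spaces are real and $Df$ denotes the Fréchet derivative. For an open subset $U$ of a normed linear space, $C^{1,+}(U)$ is the set of all Fréchet differentiable $f\colon U\to\mathbb R$ such that $Df$ is uniformly continuous on $U$, and $C^{1,+}_{\mathrm B}(U)$ is the set of all Fréchet differentiable $f\colon U\to\mathbb R$ such that $Df$ is uniformly continuous on each bounded subset of $U$. A metric space $(Z,\rho)$ is $c$-quasiconvex ($c\ge1$) if for each $x,y\in Z$ there is a continuous rectifiable curve $\gamma\colon[0,1]\to Z$ with $\gamma(0)=x$, $\gamma(1)=y$ and length (variation) at most $c\rho(x,y)$; it is quasiconvex if it is $c$-quasiconvex for some $c\ge1$. Subsets of normed spaces carry the norm metric. A Banach space is super-reflexive if and only if it has an equivalent uniformly smooth norm. *)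

theory Defs
  imports "HOL-Analysis.Analysis"
begin

definition is_norm :: "('a::real_vector \<Rightarrow> real) \<Rightarrow> bool" where
  "is_norm N \<longleftrightarrow>
     (\<forall>x. N x = 0 \<longleftrightarrow> x = 0) \<and>
     (\<forall>c x. N (c *\<^sub>R x) = \<bar>c\<bar> * N x) \<and>
     (\<forall>x y. N (x + y) \<le> N x + N y)"

definition equivalent_norm :: "('a::real_normed_vector \<Rightarrow> real) \<Rightarrow> bool" where
  "equivalent_norm N \<longleftrightarrow>
     is_norm N \<and> (\<exists>a>0. \<exists>b>0. \<forall>x. a * norm x \<le> N x \<and> N x \<le> b * norm x)"

definition uniformly_smooth_norm :: "('a::real_vector \<Rightarrow> real) \<Rightarrow> bool" where
  "uniformly_smooth_norm N \<longleftrightarrow>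
     (\<forall>\<epsilon>>0. \<exists>\<delta>>0. \<forall>x y. N x = 1 \<longrightarrow> N y \<le> \<delta> \<longrightarrow> N (x + y) + N (x - y) \<le> 2 + \<epsilon> * N y)"

(* The definition through finite representability quantifies over all Banach spaces, which a
   single HOL formula cannot do; this is the renorming description of super-reflexivity
   (Enflo, James, Pisier).  The argument is only a type token for the space. *)
definition super_reflexive :: "'a::banach itself \<Rightarrow> bool" where
  "super_reflexive _ \<longleftrightarrow>
     (\<exists>N :: 'a \<Rightarrow> real. equivalent_norm N \<and> uniformly_smooth_norm N)"

(* Supremum of the sums over all t 0 \<le> ... \<le> t n in [0,1]; possibly infinite. *)
definition curve_length :: "(real \<Rightarrow> 'a::metric_space) \<Rightarrow> ennreal" where
  "curve_length \<gamma> =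
     (SUP (n, t) \<in> {(n :: nat, t :: nat \<Rightarrow> real). mono_on {..n} t \<and> t ` {..n} \<subseteq> {0..1}}.
        ennreal (\<Sum>i<n. dist (\<gamma> (t i)) (\<gamma> (t (Suc i)))))"

(* The length bound contains rectifiability, since the right-hand side is finite. *)
definition c_quasiconvex :: "real \<Rightarrow> 'a::metric_space set \<Rightarrow> bool" where
  "c_quasiconvex c Z \<longleftrightarrow>
     (\<forall>x\<in>Z. \<forall>y\<in>Z. \<exists>\<gamma>. path \<gamma> \<and> path_image \<gamma> \<subseteq> Z \<and> pathstart \<gamma> = x \<and> pathfinish \<gamma> = y \<and>
        curve_length \<gamma> \<le> ennreal (c * dist x y))"

definition quasiconvex :: "'a::metric_space set \<Rightarrow> bool" where
  "quasiconvex Z \<longleftrightarrow> (\<exists>c\<ge>1. c_quasiconvex c Z)"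

(* Meant for open U, where the derivative is unique; values of f and D off U do not matter. *)
definition C1plus :: "'a::real_normed_vector set \<Rightarrow> ('a \<Rightarrow> real) set" where
  "C1plus U = {f. \<exists>D :: 'a \<Rightarrow> ('a \<Rightarrow>\<^sub>L real).
     (\<forall>x\<in>U. (f has_derivative blinfun_apply (D x)) (at x)) \<and> uniformly_continuous_on U D}"

definition C1plusB :: "'a::real_normed_vector set \<Rightarrow> ('a \<Rightarrow> real) set" where
  "C1plusB U = {f. \<exists>D :: 'a \<Rightarrow> ('a \<Rightarrow>\<^sub>L real).
     (\<forall>x\<in>U. (f has_derivative blinfun_apply (D x)) (at x)) \<and>
     (\<forall>B\<subseteq>U. bounded B \<longrightarrow> uniformly_continuous_on B D)}"

end

theory Submission
  imports Defs
begin

text \<open>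
  The theorem is a Whitney extension theorem whose remainder is measured by a gauge built from a
  uniformly smooth norm.

  Call \<open>gap u t z d\<close> the amount by which the chord of \<open>u\<close> over the segment from \<open>z - t d\<close> to
  \<open>z + (1 - t) d\<close> lies above \<open>u\<close> at \<open>z\<close>.  If \<open>gap u t z d\<close> is at most
  \<open>t (1 - t) \<theta> d\<close> for all \<open>t\<close> in \<open>[0, 1]\<close>, \<open>z\<close> and \<open>d\<close>, then \<open>u\<close> is semiconcave with modulus \<open>\<theta>\<close>; if
  \<open>gap u t z d\<close> is at least the negative of that bound, \<open>u\<close> is semiconvex.  A locally bounded function
  that is both, for one \<open>\<theta>\<close> with \<open>\<theta> d = o(norm d)\<close>, is Frechet differentiable with uniformly
  continuous derivative (\<open>small_gap_imp_C1\<close>): its difference quotients along each ray are Cauchy at a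
  rate that \<open>\<theta>\<close> controls.

  Let \<open>(f, G)\<close> be a first order jet on a set \<open>E\<close> whose Whitney remainders are small near the diagonal
  and bounded.  Uniform smoothness of an equivalent norm yields a semiconcave gauge \<open>\<psi>\<close> that dominates
  these remainders (\<open>smooth_gauge_exists\<close>); it is a series of smoothings of the norm at
  different scales.  With this domination,
  each function \<open>f z + G z (x - z) - \<psi> (x - z)\<close> lies below each function
  \<open>f y + G y (x - y) + \<psi> (x - y)\<close>, for \<open>y\<close>, \<open>z\<close> in \<open>E\<close>.  The former are semiconvex, the latter
  semiconcave.  The largest semiconvex function \<open>F\<close> below all of the latter is automatically
  semiconcave: the average of its translates, shifted down by the modulus, is again an
  admissible competitor (\<open>insertion_envelope\<close>).  Hence \<open>F\<close> is smooth, and it equals \<open>f\<close> on \<open>E\<close> because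
  the two families touch there (\<open>whitney_extension\<close>).

  Quasiconvexity makes \<open>(f, Df)\<close> such a jet on every bounded part of \<open>U\<close>: the mean value theorem
  is applied along a polygon of length at most \<open>c\<close> times the distance
  (\<open>quasiconvex_jet_estimates\<close>).  On an unbounded \<open>U\<close> the remainders may grow too fast for one gauge,
  so the extensions for the balls of radius \<open>n + 1\<close> are glued with a smooth partition of unity.
  Its cutoff functions come from \<open>whitney_extension\<close> again, applied to the jet of a function that is 1 on
  a ball and 0 far from it.  The gluing is locally finite, and so regularity of the sum
  holds on bounded sets only.
\<close>

section \<open>Chord gaps of a uniformly smooth norm\<close>

text \<open>The factors \<open>t\<close> and \<open>1 - t\<close> are placed so that \<open>z\<close> is the convex combination of the two end points,
  whose difference is \<open>d\<close>.  The gap is linear in \<open>u\<close>, nonnegative for convex \<open>u\<close>, and at \<open>t = 1/2\<close> it is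
  half of a second difference.\<close>
definition gap :: "('a::real_vector \<Rightarrow> real) \<Rightarrow> real \<Rightarrow> 'a \<Rightarrow> 'a \<Rightarrow> real" where
  "gap u t z d = (1 - t) * u (z - t *\<^sub>R d) + t * u (z + (1 - t) *\<^sub>R d) - u z"

lemma gap_swap: "gap u t z d = gap u (1 - t) z (- d)"
  by (simp add: gap_def)

lemma is_normD:
  assumes "is_norm N"
  shows is_norm_eq_0: "N x = 0 \<longleftrightarrow> x = 0"
    and is_norm_scaleR: "N (c *\<^sub>R x) = \<bar>c\<bar> * N x"
    and is_norm_triangle: "N (x + y) \<le> N x + N y"
  using assms unfolding is_norm_def by blast+

lemma is_norm_minus: "is_norm N \<Longrightarrow> N (- x) = N x"
  using is_norm_scaleR[of N "-1" x] by simp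

lemma is_norm_nonneg:
  assumes "is_norm N" shows "0 \<le> N x"
  using is_norm_triangle[OF assms, of x "- x"] is_norm_minus[OF assms, of x]
    is_norm_eq_0[OF assms, of 0] by simp

lemma is_norm_add_diff_abs:
  assumes "is_norm N" shows "\<bar>N (x + y) - N x\<bar> \<le> N y"
  using is_norm_triangle[OF assms, of x y] is_norm_triangle[OF assms, of "x + y" "- y"]
    is_norm_minus[OF assms, of y] by simp

lemma norm_endpoints:
  assumes "is_norm N" "0 \<le> t" "t \<le> 1"
  shows "\<bar>N (z - t *\<^sub>R d) - N z\<bar> \<le> t * N d"
    and "\<bar>N (z + (1 - t) *\<^sub>R d) - N z\<bar> \<le> (1 - t) * N d"
  using is_norm_add_diff_abs[OF assms(1), of z "- (t *\<^sub>R d)"]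
    is_norm_add_diff_abs[OF assms(1), of z "(1 - t) *\<^sub>R d"] assms
  by (auto simp: is_norm_minus is_norm_scaleR)

lemma lipschitz_gap_le:
  fixes u :: "'a::real_vector \<Rightarrow> real"
  assumes t: "0 \<le> t" "t \<le> 1"
    and 1: "u (z - t *\<^sub>R d) - u z \<le> t * c" and 2: "u (z + (1 - t) *\<^sub>R d) - u z \<le> (1 - t) * c"
  shows "gap u t z d \<le> t * (1 - t) * (2 * c)"
proof -
  have "gap u t z d = (1 - t) * (u (z - t *\<^sub>R d) - u z) + t * (u (z + (1 - t) *\<^sub>R d) - u z)"
    by (simp add: gap_def algebra_simps)
  also have "\<dots> \<le> (1 - t) * (t * c) + t * ((1 - t) * c)"
    using t 1 2 by (intro add_mono mult_left_mono) auto
  finally show ?thesis by (simp add: algebra_simps)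
qed

lemma uniformly_smooth_scaled:
  assumes N: "is_norm N"
    and smooth: "\<And>x y. N x = 1 \<Longrightarrow> N y \<le> \<delta> \<Longrightarrow> N (x + y) + N (x - y) \<le> 2 + \<epsilon> * N y"
    and h: "N h \<le> \<delta> * N z"
  shows "N (z + h) + N (z - h) \<le> 2 * N z + \<epsilon> * N h"
proof (cases "z = 0")
  case True
  then have "N z = 0" using N by (simp add: is_norm_eq_0)
  then have "h = 0" using h is_norm_nonneg[OF N, of h] by (simp add: is_norm_eq_0[OF N, symmetric])
  then show ?thesis using True \<open>N z = 0\<close> by simp
next
  case False
  then have n: "N z > 0" using is_norm_nonneg[OF N, of z] is_norm_eq_0[OF N, of z] by linarith
  define x y where "x = inverse (N z) *\<^sub>R z" and "y = inverse (N z) *\<^sub>R h"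
  have Nx: "N x = 1" and Ny: "N y = N h / N z" using n
    by (simp_all add: x_def y_def is_norm_scaleR[OF N] divide_inverse)
  have "N y \<le> \<delta>" using n h by (simp add: Ny divide_le_eq)
  then have *: "N (x + y) + N (x - y) \<le> 2 + \<epsilon> * N y" by (rule smooth[OF Nx])
  have 1: "z + h = N z *\<^sub>R (x + y)" and 2: "z - h = N z *\<^sub>R (x - y)"
    using n by (simp_all add: x_def y_def algebra_simps)
  have "N (z + h) + N (z - h) = N z * (N (x + y) + N (x - y))"
    unfolding 1 2 is_norm_scaleR[OF N] using n by (simp add: distrib_left)
  also have "\<dots> \<le> N z * (2 + \<epsilon> * N y)" using * n by simp
  also have "\<dots> = 2 * N z + \<epsilon> * N h" using n by (simp add: Ny field_simps)
  finally show ?thesis .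
qed

text \<open>Uniform smoothness bounds symmetric second differences only.  For \<open>t \<le> 1/2\<close> convexity reduces the
  gap to one: \<open>z - t d\<close> lies between \<open>z\<close> and \<open>z - (1 - t) d\<close>, and the latter is the mirror image
  of the other end point \<open>z + (1 - t) d\<close>.\<close>
lemma uniformly_smooth_gap:
  assumes N: "is_norm N" and t: "0 \<le> t" "t \<le> 1"
    and smooth: "\<And>x y. N x = 1 \<Longrightarrow> N y \<le> \<delta> \<Longrightarrow> N (x + y) + N (x - y) \<le> 2 + \<epsilon> * N y"
    and d: "N d \<le> \<delta> * N z"
  shows "gap N t z d \<le> t * (1 - t) * (\<epsilon> * N d)"
proof -
  have half: "gap N s z e \<le> s * (1 - s) * (\<epsilon> * N e)"
    if s: "0 \<le> s" "s \<le> 1 / 2" and e: "N e \<le> \<delta> * N z" for s e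
  proof -
    have "N ((1 - s) *\<^sub>R e) \<le> N e"
      using s is_norm_nonneg[OF N, of e] by (simp add: is_norm_scaleR[OF N] mult_left_le_one_le)
    then have A: "N (z + (1 - s) *\<^sub>R e) + N (z - (1 - s) *\<^sub>R e) \<le> 2 * N z + \<epsilon> * N ((1 - s) *\<^sub>R e)"
      by (intro uniformly_smooth_scaled[OF N, where \<delta> = \<delta>] smooth) (use e in auto)
    have "(1 - s) * N (z - s *\<^sub>R e) = N ((1 - s) *\<^sub>R (z - s *\<^sub>R e))"
      using s by (simp add: is_norm_scaleR[OF N])
    also have "(1 - s) *\<^sub>R (z - s *\<^sub>R e) = (1 - 2 * s) *\<^sub>R z + s *\<^sub>R (z - (1 - s) *\<^sub>R e)"
      by (simp add: algebra_simps) (simp add: scaleR_add_left[symmetric])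
    also have "N \<dots> \<le> (1 - 2 * s) * N z + s * N (z - (1 - s) *\<^sub>R e)"
      using is_norm_triangle[OF N, of "(1 - 2 * s) *\<^sub>R z" "s *\<^sub>R (z - (1 - s) *\<^sub>R e)"] s
      by (simp add: is_norm_scaleR[OF N])
    finally have "gap N s z e \<le> s * (N (z + (1 - s) *\<^sub>R e) + N (z - (1 - s) *\<^sub>R e) - 2 * N z)"
      by (simp add: gap_def algebra_simps)
    also have "\<dots> \<le> s * (\<epsilon> * N ((1 - s) *\<^sub>R e))"
      using A s by (intro mult_left_mono) auto
    finally show ?thesis using s unfolding is_norm_scaleR[OF N] by (simp add: mult_ac)
  qed
  show ?thesis
  proof (cases "t \<le> 1 / 2")
    case True then show ?thesis using half t d by blast
  next
    case False
    then show ?thesis using half[of "1 - t" "- d"] t d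
      by (subst gap_swap) (simp add: is_norm_minus[OF N] algebra_simps)
  qed
qed

section \<open>A gauge that dominates a given modulus\<close>

text \<open>The norm itself is not differentiable at 0.  For \<open>n \<ge> 0\<close> this function is quadratic at scales
  below \<open>r\<close> and comparable to \<open>n\<close> above; equivalently it is \<open>n - r + r\<^sup>2 / (r + n)\<close>, which gives a closed
  form of its Taylor remainder.\<close>
definition smoothed_abs :: "real \<Rightarrow> real \<Rightarrow> real" where
  "smoothed_abs r n = n\<^sup>2 / (r + n)"

lemma smoothed_abs_expansion:
  assumes "0 < r" "0 \<le> n" "0 \<le> p"
  shows "smoothed_abs r p = smoothed_abs r n + (1 - r\<^sup>2 / (r + n)\<^sup>2) * (p - n) + r\<^sup>2 * (p - n)\<^sup>2 / ((r + n)\<^sup>2 * (r + p))"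
proof -
  have h: "smoothed_abs r q = q - r + r\<^sup>2 / (r + q)" if "0 \<le> q" for q
    using that assms by (simp add: smoothed_abs_def field_simps power2_eq_square)
  have "r\<^sup>2 / (r + p) - r\<^sup>2 / (r + n) = r\<^sup>2 * (p - n)\<^sup>2 / ((r + n)\<^sup>2 * (r + p)) - r\<^sup>2 / (r + n)\<^sup>2 * (p - n)"
  proof -
    have *: "r + n \<noteq> 0" "r + p \<noteq> 0" using assms by auto
    show ?thesis using * by (simp add: divide_simps) algebra
  qed
  then show ?thesis using h[of p] h[of n] assms by (simp add: algebra_simps)
qed

lemma smoothed_abs_slope_nonneg:
  fixes r n :: real
  shows "0 < r \<Longrightarrow> 0 \<le> n \<Longrightarrow> 0 \<le> 1 - r\<^sup>2 / (r + n)\<^sup>2"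
proof -
  assume r: "0 < r" "0 \<le> n"
  have "r\<^sup>2 \<le> (r + n)\<^sup>2" using r by (intro power_mono) auto
  moreover have "0 < (r + n)\<^sup>2" using r by (intro zero_less_power) linarith
  ultimately show ?thesis by (simp add: divide_le_eq)
qed

lemma smoothed_abs_slope_le:
  fixes r n :: real
  assumes "0 < r" "0 \<le> n" shows "1 - r\<^sup>2 / (r + n)\<^sup>2 \<le> 2 * n / r"
proof -
  define q where "q = r / (r + n)"
  have "r + n \<noteq> 0" using assms by linarith
  then have "1 - q = n / (r + n)" by (simp add: q_def field_simps)
  also have "\<dots> \<le> n / r" using assms by (intro divide_left_mono) auto
  finally have q: "1 - q \<le> n / r" "0 \<le> q" "q \<le> 1" using assms
    by (auto simp: q_def)
  have "1 - r\<^sup>2 / (r + n)\<^sup>2 = (1 - q) * (1 + q)"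
    by (simp add: q_def power_divide[symmetric] algebra_simps power2_eq_square)
  also have "\<dots> \<le> (n / r) * 2" using q by (intro mult_mono) auto
  finally show ?thesis by (simp add: mult.commute)
qed

lemma smoothed_abs_le_taylor:
  assumes "0 < r" "0 \<le> n" "0 \<le> p"
  shows "smoothed_abs r p \<le> smoothed_abs r n + (1 - r\<^sup>2 / (r + n)\<^sup>2) * (p - n) + (p - n)\<^sup>2 / r"
proof -
  have "r\<^sup>2 * r \<le> (r + n)\<^sup>2 * (r + p)" using assms by (intro mult_mono power_mono) auto
  then have "r\<^sup>2 * (p - n)\<^sup>2 / ((r + n)\<^sup>2 * (r + p)) \<le> r\<^sup>2 * (p - n)\<^sup>2 / (r\<^sup>2 * r)"
    using assms by (intro divide_left_mono) (auto intro!: mult_pos_pos)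
  also have "\<dots> = (p - n)\<^sup>2 / r" using assms by simp
  finally show ?thesis using smoothed_abs_expansion[OF assms] by linarith
qed

lemma smoothed_abs_diff_le:
  assumes "0 < r" "0 \<le> n" "0 \<le> p"
  shows "smoothed_abs r p - smoothed_abs r n \<le> \<bar>p - n\<bar>"
proof -
  have e: "smoothed_abs r p - smoothed_abs r n = (p - n) * (1 - r\<^sup>2 / ((r + p) * (r + n)))"
  proof -
    have *: "r + n \<noteq> 0" "r + p \<noteq> 0" using assms by auto
    show ?thesis unfolding smoothed_abs_def using * by (simp add: divide_simps) algebra
  qed
  have "r * r \<le> (r + p) * (r + n)" using assms by (intro mult_mono) auto
  then have "0 \<le> 1 - r\<^sup>2 / ((r + p) * (r + n))" "1 - r\<^sup>2 / ((r + p) * (r + n)) \<le> 1"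
    using assms by (auto simp: divide_le_eq power2_eq_square)
  then have "\<bar>p - n\<bar> * (1 - r\<^sup>2 / ((r + p) * (r + n))) \<le> \<bar>p - n\<bar>"
    by (simp add: mult_left_le)
  moreover have "(p - n) * (1 - r\<^sup>2 / ((r + p) * (r + n))) \<le> \<bar>p - n\<bar> * (1 - r\<^sup>2 / ((r + p) * (r + n)))"
    using \<open>0 \<le> 1 - r\<^sup>2 / ((r + p) * (r + n))\<close> by (intro mult_right_mono) auto
  ultimately show ?thesis unfolding e by (rule order_trans[rotated])
qed

lemma smoothed_abs_bounds:
  assumes "0 < r" "0 \<le> n"
  shows "0 \<le> smoothed_abs r n" "smoothed_abs r n \<le> n" "r \<le> n \<Longrightarrow> n / 2 \<le> smoothed_abs r n"
  using assms by (auto simp: smoothed_abs_def divide_simps power2_eq_square algebra_simps)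

lemma smoothed_abs_gap_lipschitz:
  assumes N: "is_norm N" and r: "0 < r" and t: "0 \<le> t" "t \<le> 1"
  shows "gap (\<lambda>x. smoothed_abs r (N x)) t z d \<le> t * (1 - t) * (2 * N d)"
proof (rule lipschitz_gap_le[OF t])
  note le = smoothed_abs_diff_le[OF r is_norm_nonneg[OF N] is_norm_nonneg[OF N]]
  show "smoothed_abs r (N (z - t *\<^sub>R d)) - smoothed_abs r (N z) \<le> t * N d"
    using le[of "z - t *\<^sub>R d" z] norm_endpoints(1)[OF N t, of z d] by linarith
  show "smoothed_abs r (N (z + (1 - t) *\<^sub>R d)) - smoothed_abs r (N z) \<le> (1 - t) * N d"
    using le[of "z + (1 - t) *\<^sub>R d" z] norm_endpoints(2)[OF N t, of z d] by linarith
qed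

lemma smoothed_abs_gap_taylor:
  assumes N: "is_norm N" and r: "0 < r" and t: "0 \<le> t" "t \<le> 1"
  shows "gap (\<lambda>x. smoothed_abs r (N x)) t z d
      \<le> (1 - r\<^sup>2 / (r + N z)\<^sup>2) * gap N t z d + t * (1 - t) * (N d * (N d / r))"
proof -
  define n p m k where "n = N z" and "p = N (z - t *\<^sub>R d)" and "m = N (z + (1 - t) *\<^sub>R d)"
    and "k = 1 - r\<^sup>2 / (r + n)\<^sup>2"
  have nn: "0 \<le> n" "0 \<le> p" "0 \<le> m" "0 \<le> N d"
    using is_norm_nonneg[OF N] by (auto simp: n_def p_def m_def)
  have "(1 - t) * smoothed_abs r p \<le> (1 - t) * (smoothed_abs r n + k * (p - n) + (p - n)\<^sup>2 / r)"
    using smoothed_abs_le_taylor[OF r] nn t unfolding k_def by (intro mult_left_mono) auto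
  moreover have "t * smoothed_abs r m \<le> t * (smoothed_abs r n + k * (m - n) + (m - n)\<^sup>2 / r)"
    using smoothed_abs_le_taylor[OF r] nn t unfolding k_def by (intro mult_left_mono) auto
  ultimately have "gap (\<lambda>x. smoothed_abs r (N x)) t z d
      \<le> (1 - t) * (smoothed_abs r n + k * (p - n) + (p - n)\<^sup>2 / r)
        + t * (smoothed_abs r n + k * (m - n) + (m - n)\<^sup>2 / r) - smoothed_abs r n"
    by (simp add: gap_def n_def p_def m_def)
  also have "\<dots> = k * gap N t z d + ((1 - t) * (p - n)\<^sup>2 + t * (m - n)\<^sup>2) / r"
  proof -
    have g: "gap N t z d = (1 - t) * p + t * m - n" by (simp add: gap_def n_def p_def m_def)
    show ?thesis unfolding g using r by (simp add: field_simps)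
  qed
  finally have "gap (\<lambda>x. smoothed_abs r (N x)) t z d
      \<le> k * gap N t z d + ((1 - t) * (p - n)\<^sup>2 + t * (m - n)\<^sup>2) / r" .
  moreover have "(p - n)\<^sup>2 \<le> (t * N d)\<^sup>2" "(m - n)\<^sup>2 \<le> ((1 - t) * N d)\<^sup>2"
    using norm_endpoints[OF N t, of z d] nn t by (auto simp: n_def p_def m_def intro: abs_le_square_iff[THEN iffD1])
  then have "((1 - t) * (p - n)\<^sup>2 + t * (m - n)\<^sup>2) / r
      \<le> ((1 - t) * (t * N d)\<^sup>2 + t * ((1 - t) * N d)\<^sup>2) / r"
    using t r by (intro divide_right_mono add_mono mult_left_mono) auto
  moreover have "((1 - t) * (t * N d)\<^sup>2 + t * ((1 - t) * N d)\<^sup>2) = t * (1 - t) * (N d * N d)"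
    by (simp add: power2_eq_square algebra_simps)
  ultimately show ?thesis by (simp add: k_def n_def)
qed

text \<open>The second order term of \<open>smoothed_abs_gap_taylor\<close> is harmless for small \<open>d\<close>.  In the first order term,
  either \<open>d\<close> is small relative to \<open>z\<close>, and the gap of \<open>N\<close> is small by uniform smoothness, or \<open>z\<close> is
  itself of the order of \<open>d\<close>, and then the slope of \<open>smoothed_abs r\<close> at \<open>N z\<close> is small.\<close>
lemma smoothed_abs_gap_small:
  assumes N: "is_norm N" and us: "uniformly_smooth_norm N" and r: "0 < r" and \<epsilon>: "0 < \<epsilon>"
  shows "\<exists>\<delta>>0. \<forall>t z d. 0 \<le> t \<longrightarrow> t \<le> 1 \<longrightarrow> N d \<le> \<delta> \<longrightarrow>
      gap (\<lambda>x. smoothed_abs r (N x)) t z d \<le> t * (1 - t) * (\<epsilon> * N d)"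
proof -
  obtain \<delta>0 where \<delta>0: "0 < \<delta>0"
    and sm: "\<And>x y. N x = 1 \<Longrightarrow> N y \<le> \<delta>0 \<Longrightarrow> N (x + y) + N (x - y) \<le> 2 + (\<epsilon> / 2) * N y"
    using us \<epsilon> unfolding uniformly_smooth_norm_def by (meson half_gt_zero)
  define \<delta> where "\<delta> = min (r * \<epsilon> / 2) (r * \<epsilon> / (4 / \<delta>0 + 1))"
  have "0 < \<delta>" using r \<epsilon> \<delta>0 by (simp add: \<delta>_def add_pos_pos)
  moreover have "gap (\<lambda>x. smoothed_abs r (N x)) t z d \<le> t * (1 - t) * (\<epsilon> * N d)"
    if t: "0 \<le> t" "t \<le> 1" and d: "N d \<le> \<delta>" for t z d
  proof -
    define k where "k = 1 - r\<^sup>2 / (r + N z)\<^sup>2"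
    note nn = is_norm_nonneg[OF N]
    have k: "0 \<le> k" "k \<le> 1" "k \<le> 2 * N z / r"
      using smoothed_abs_slope_nonneg[OF r nn, of z] smoothed_abs_slope_le[OF r nn, of z] by (auto simp: k_def)
    have tt: "0 \<le> t * (1 - t)" using t by simp
    have main: "gap (\<lambda>x. smoothed_abs r (N x)) t z d \<le> k * gap N t z d + t * (1 - t) * (N d * (N d / r))"
      unfolding k_def by (rule smoothed_abs_gap_taylor[OF N r t])
    show ?thesis
    proof (cases "N d \<le> \<delta>0 * N z")
      case True
      have "k * gap N t z d \<le> k * (t * (1 - t) * (\<epsilon> / 2 * N d))"
        using uniformly_smooth_gap[OF N t sm True] \<epsilon> k by (intro mult_left_mono) auto
      also have "\<dots> \<le> t * (1 - t) * (\<epsilon> / 2 * N d)"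
        using k tt nn[of d] \<epsilon> by (intro mult_left_le_one_le) simp_all
      finally have "gap (\<lambda>x. smoothed_abs r (N x)) t z d
          \<le> t * (1 - t) * (N d * (\<epsilon> / 2)) + t * (1 - t) * (N d * (N d / r))" using main by (simp add: mult.commute)
      also have "\<dots> = t * (1 - t) * (N d * (\<epsilon> / 2 + N d / r))" by (simp add: algebra_simps)
      also have "\<dots> \<le> t * (1 - t) * (N d * \<epsilon>)"
      proof (intro mult_left_mono tt nn)
        have "N d \<le> r * \<epsilon> / 2" using d by (simp add: \<delta>_def)
        then show "\<epsilon> / 2 + N d / r \<le> \<epsilon>" using r by (simp add: field_simps)
      qed
      finally show ?thesis by (simp add: mult.commute)
    next
      case False
      then have "N z \<le> N d / \<delta>0" using \<delta>0 by (simp add: field_simps)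
      then have k': "k \<le> 2 * (N d / \<delta>0) / r"
        using k(3) r by (meson divide_right_mono less_imp_le mult_left_mono order_trans zero_le_numeral)
      have g: "gap N t z d \<le> t * (1 - t) * (2 * N d)"
        using norm_endpoints[OF N t, of z d] by (intro lipschitz_gap_le[OF t]) auto
      have "k * gap N t z d \<le> k * (t * (1 - t) * (2 * N d))" using g k by (intro mult_left_mono)
      also have "\<dots> \<le> 2 * (N d / \<delta>0) / r * (t * (1 - t) * (2 * N d))"
        using k' tt nn[of d] by (intro mult_right_mono) simp_all
      finally have "gap (\<lambda>x. smoothed_abs r (N x)) t z d
         \<le> 2 * (N d / \<delta>0) / r * (t * (1 - t) * (2 * N d)) + t * (1 - t) * (N d * (N d / r))" using main by simp
      also have "\<dots> = t * (1 - t) * (N d * (N d * (4 / \<delta>0 + 1) / r))"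
        using r \<delta>0 by (simp add: field_simps)
      also have "\<dots> \<le> t * (1 - t) * (N d * \<epsilon>)"
      proof (intro mult_left_mono tt nn)
        have "N d \<le> r * \<epsilon> / (4 / \<delta>0 + 1)" using d by (simp add: \<delta>_def)
        moreover have "0 < 4 / \<delta>0 + 1" using \<delta>0 by (simp add: add_pos_pos)
        ultimately have "N d * (4 / \<delta>0 + 1) \<le> r * \<epsilon>" by (simp add: pos_le_divide_eq)
        then show "N d * (4 / \<delta>0 + 1) / r \<le> \<epsilon>" using r by (simp add: pos_divide_le_eq mult.commute)
      qed
      finally show ?thesis by (simp add: mult.commute)
    qed
  qed
  ultimately show ?thesis by blast
qed

text \<open>The sequence \<open>\<delta>\<close> encodes an arbitrary modulus: level \<open>C / 2 ^ k\<close> has to be dominated from distance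
  \<open>\<delta> k\<close> on.  A weighted series of smoothings, with scale \<open>\<delta> k\<close> in the term of weight of order \<open>C / 2 ^ k\<close>,
  does this since already one term suffices for each level.  The gap of the series is small for small \<open>d\<close>
  because finitely many terms have this property and the others have small total weight.\<close>
lemma smooth_gauge_exists:
  fixes \<delta> :: "nat \<Rightarrow> real"
  assumes sr: "super_reflexive TYPE('a::banach)" and \<delta>: "\<And>k. 0 < \<delta> k" and C: "0 < C"
  obtains \<psi> :: "'a::banach \<Rightarrow> real" and L where "\<psi> 0 = 0" "\<And>x. 0 \<le> \<psi> x"
    "\<And>k x. \<delta> k \<le> norm x \<Longrightarrow> C / 2 ^ k * norm x \<le> \<psi> x"
    "\<And>t z d. 0 \<le> t \<Longrightarrow> t \<le> 1 \<Longrightarrow> gap \<psi> t z d \<le> t * (1 - t) * (L * norm d)"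
    "\<And>\<epsilon>. 0 < \<epsilon> \<Longrightarrow> \<exists>\<eta>>0. \<forall>t z d. 0 \<le> t \<longrightarrow> t \<le> 1 \<longrightarrow> norm d \<le> \<eta> \<longrightarrow>
        gap \<psi> t z d \<le> t * (1 - t) * (\<epsilon> * norm d)"
proof -
  obtain N :: "'a \<Rightarrow> real" and a b where N: "is_norm N" and us: "uniformly_smooth_norm N"
    and a: "0 < a" "\<And>x. a * norm x \<le> N x" and b: "0 < b" "\<And>x. N x \<le> b * norm x"
    using sr unfolding super_reflexive_def equivalent_norm_def by blast
  note nn = is_norm_nonneg[OF N]
  \<comment> \<open>The factor 2 compensates the 1/2 in \<open>smoothed_abs_bounds(3)\<close>, and \<open>a\<close> the passage from \<open>norm\<close> to \<open>N\<close>.\<close>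
  define c where "c k = 2 * C / a / 2 ^ k" for k :: nat
  define r where "r k = a * \<delta> k" for k
  have c0: "0 < c k" for k using C a by (simp add: c_def)
  have r0: "0 < r k" for k using \<delta> a by (simp add: r_def)
  have csum: "summable c"
    unfolding c_def divide_inverse[of _ "2 ^ _"] power_inverse[symmetric]
    by (intro summable_mult summable_geometric) auto
  define S where "S = suminf c"
  have S: "c sums S" using csum by (simp add: S_def summable_sums)
  have S0: "0 < S" unfolding S_def by (rule suminf_pos[OF csum c0])
  define h where "h k = (\<lambda>x. smoothed_abs (r k) (N x))" for k
  have h: "0 \<le> h k x" "h k x \<le> N x" for k x
    using smoothed_abs_bounds[OF r0 nn] by (auto simp: h_def)
  define \<psi> where "\<psi> x = (\<Sum>k. c k * h k x)" for x
  have sm: "summable (\<lambda>k. c k * h k x)" for x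
    using h c0 by (intro summable_comparison_test_ev[OF _ summable_mult2[OF csum, of "N x"]])
      (auto simp: abs_mult less_imp_le intro!: always_eventually mult_left_mono)
  have \<psi>: "(\<lambda>k. c k * h k x) sums \<psi> x" for x
    using sm by (simp add: \<psi>_def summable_sums)
  have gap\<psi>: "(\<lambda>k. c k * gap (h k) t z d) sums gap \<psi> t z d" for t z d
  proof -
    have "(\<lambda>k. (1 - t) * (c k * h k (z - t *\<^sub>R d)) + t * (c k * h k (z + (1 - t) *\<^sub>R d)) - c k * h k z)
        sums gap \<psi> t z d"
      unfolding gap_def by (intro sums_add sums_diff sums_mult \<psi>)
    then show ?thesis by (simp add: gap_def algebra_simps)
  qed
  have small: "\<exists>\<eta>>0. \<forall>t z d. 0 \<le> t \<longrightarrow> t \<le> 1 \<longrightarrow> norm d \<le> \<eta> \<longrightarrow>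
        gap \<psi> t z d \<le> t * (1 - t) * (\<epsilon> * norm d)" if \<epsilon>: "0 < \<epsilon>" for \<epsilon>
  proof -
    define e where "e = \<epsilon> / b"
    have e: "0 < e" using \<epsilon> b by (simp add: e_def)
    obtain K where "norm (\<Sum>i. c (i + K)) < e / 4"
      using suminf_exist_split[of "e / 4" c] csum e by auto
    then have K: "(\<Sum>i. c (i + K)) \<le> e / 4" by simp
    have "\<exists>\<eta>>0. \<forall>t z d. 0 \<le> t \<longrightarrow> t \<le> 1 \<longrightarrow> N d \<le> \<eta> \<longrightarrow>
        gap (h k) t z d \<le> t * (1 - t) * (e / (2 * S) * N d)" for k
      unfolding h_def using e S0 by (intro smoothed_abs_gap_small[OF N us r0]) auto
    then obtain \<eta> where \<eta>: "\<And>k. 0 < \<eta> k"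
      and \<eta>gap: "\<And>k t z d. 0 \<le> t \<Longrightarrow> t \<le> 1 \<Longrightarrow> N d \<le> \<eta> k \<Longrightarrow>
        gap (h k) t z d \<le> t * (1 - t) * (e / (2 * S) * N d)" by metis
    define \<rho> where "\<rho> = Min (insert 1 (\<eta> ` {..<K})) / b"
    have \<rho>: "0 < \<rho>" using b \<eta> by (auto simp: \<rho>_def)
    have "gap \<psi> t z d \<le> t * (1 - t) * (\<epsilon> * norm d)"
      if t: "0 \<le> t" "t \<le> 1" and d: "norm d \<le> \<rho>" for t z d
    proof -
      have tt: "0 \<le> t * (1 - t)" using t by simp
      have "N d \<le> b * norm d" by (rule b)
      also have "\<dots> \<le> b * \<rho>" using d b by simp
      finally have Nd: "N d \<le> Min (insert 1 (\<eta> ` {..<K}))" using b by (simp add: \<rho>_def)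
      then have Nd: "N d \<le> \<eta> k" if "k < K" for k using that by auto
      \<comment> \<open>Beyond \<open>K\<close> only the Lipschitz bound with its constant 2 is available uniformly in \<open>k\<close>.\<close>
      define w where "w k = (if k < K then 0 else 2 * c k)" for k
      have "(\<lambda>i. 2 * c (i + K)) sums (2 * (\<Sum>i. c (i + K)))"
        using csum by (intro sums_mult summable_sums) (simp add: summable_iff_shift)
      then have "(\<lambda>i. w (i + K)) sums (2 * (\<Sum>i. c (i + K)))" by (simp add: w_def)
      then have w: "w sums (2 * (\<Sum>i. c (i + K)))"
        by (subst (asm) sums_zero_iff_shift) (auto simp: w_def)
      have le: "c k * gap (h k) t z d \<le> t * (1 - t) * N d * (e / (2 * S) * c k + w k)" for k
      proof (cases "k < K")
        case True
        have "c k * gap (h k) t z d \<le> c k * (t * (1 - t) * (e / (2 * S) * N d))"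
          using \<eta>gap[OF t Nd[OF True]] c0[of k] by (intro mult_left_mono) auto
        then show ?thesis using True by (simp add: w_def mult_ac)
      next
        case False
        have "c k * gap (h k) t z d \<le> c k * (t * (1 - t) * (2 * N d))"
          using smoothed_abs_gap_lipschitz[OF N r0 t] c0[of k] unfolding h_def
          by (intro mult_left_mono) auto
        moreover have "0 \<le> t * (1 - t) * N d * (e / (2 * S) * c k)"
          using tt nn[of d] e S0 c0[of k] by (intro mult_nonneg_nonneg[OF mult_nonneg_nonneg]) auto
        ultimately show ?thesis using False by (simp add: w_def distrib_left mult_ac)
      qed
      have "gap \<psi> t z d \<le> t * (1 - t) * N d * (e / (2 * S) * S + 2 * (\<Sum>i. c (i + K)))"
        by (rule sums_le[OF le gap\<psi>]) (intro sums_mult sums_add S w)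
      also have "\<dots> \<le> t * (1 - t) * N d * e"
        using K S0 tt nn[of d] by (intro mult_left_mono) auto
      also have "\<dots> \<le> t * (1 - t) * (\<epsilon> * norm d)"
      proof -
        have "N d * e \<le> b * norm d * e" using b(2)[of d] e by (intro mult_right_mono) auto
        also have "\<dots> = \<epsilon> * norm d" using b(1) by (simp add: e_def)
        finally have "t * (1 - t) * (N d * e) \<le> t * (1 - t) * (\<epsilon> * norm d)" using tt by (rule mult_left_mono)
        then show ?thesis by (simp only: mult.assoc)
      qed
      finally show ?thesis .
    qed
    then show ?thesis using \<rho> by blast
  qed
  have "C / 2 ^ k * norm x \<le> \<psi> x" if "\<delta> k \<le> norm x" for k x
  proof -
    have "r k \<le> a * norm x" using that a by (simp add: r_def)
    also have "\<dots> \<le> N x" by (rule a)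
    finally have "N x / 2 \<le> h k x" using smoothed_abs_bounds(3)[OF r0 nn] by (simp add: h_def)
    then have "a * norm x / 2 \<le> h k x" using a(2)[of x] by linarith
    then have "c k * (a * norm x / 2) \<le> c k * h k x" using c0[of k] by simp
    also have "\<dots> = (\<Sum>i\<in>{k}. c i * h i x)" by simp
    also have "\<dots> \<le> \<psi> x"
      unfolding \<psi>_def using c0 h by (intro sum_le_suminf sm) (auto simp: less_imp_le)
    finally show ?thesis using a by (simp add: c_def)
  qed
  moreover have "gap \<psi> t z d \<le> t * (1 - t) * (2 * b * S * norm d)" if t: "0 \<le> t" "t \<le> 1" for t z d
  proof -
    have le: "c k * gap (h k) t z d \<le> t * (1 - t) * (2 * N d) * c k" for k
      using mult_left_mono[OF smoothed_abs_gap_lipschitz[OF N r0 t, of k z d] less_imp_le[OF c0, of k]]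
      by (simp add: h_def mult_ac)
    have "gap \<psi> t z d \<le> t * (1 - t) * (2 * N d) * S"
      by (rule sums_le[OF le gap\<psi> sums_mult[OF S]])
    also have "\<dots> \<le> t * (1 - t) * (2 * (b * norm d)) * S"
      using b(2)[of d] t S0 by (intro mult_right_mono mult_left_mono) auto
    finally show ?thesis by (simp add: mult_ac)
  qed
  moreover have "\<psi> 0 = 0"
    using is_norm_eq_0[OF N, of 0] by (simp add: \<psi>_def h_def smoothed_abs_def)
  moreover have "0 \<le> \<psi> x" for x
    unfolding \<psi>_def using c0 h by (intro suminf_nonneg sm) (auto simp: less_imp_le)
  ultimately show ?thesis using that small by blast
qed

text \<open>Semiconvexity is preserved by suprema only for a fixed modulus, so the epsilon-delta
  bound is turned into one function \<open>\<theta>\<close>, the best possible one.\<close>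
lemma gap_modulus_exists:
  fixes \<psi> :: "'a::real_normed_vector \<Rightarrow> real"
  assumes lip: "\<And>t z d. 0 \<le> t \<Longrightarrow> t \<le> 1 \<Longrightarrow> gap \<psi> t z d \<le> t * (1 - t) * (L * norm d)"
    and small: "\<And>\<epsilon>. 0 < \<epsilon> \<Longrightarrow> \<exists>\<eta>>0. \<forall>t z d. 0 \<le> t \<longrightarrow> t \<le> 1 \<longrightarrow> norm d \<le> \<eta> \<longrightarrow>
        gap \<psi> t z d \<le> t * (1 - t) * (\<epsilon> * norm d)"
  obtains \<theta> where
    "\<And>t z d. 0 \<le> t \<Longrightarrow> t \<le> 1 \<Longrightarrow> gap \<psi> t z d \<le> t * (1 - t) * \<theta> d"
    "\<And>d. \<theta> d \<le> L * norm d"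
    "\<And>\<epsilon>. 0 < \<epsilon> \<Longrightarrow> \<exists>\<eta>>0. \<forall>d. norm d \<le> \<eta> \<longrightarrow> \<theta> d \<le> \<epsilon> * norm d"
proof -
  define Q where "Q d = (\<lambda>(t, z). gap \<psi> t z d / (t * (1 - t))) ` ({0<..<1} \<times> UNIV)" for d
  define \<theta> where "\<theta> d = Sup (Q d)" for d
  have ne: "Q d \<noteq> {}" for d by (auto simp: Q_def intro!: exI[of _ "1 / 2 :: real"])
  have up: "q \<le> c" if q: "q \<in> Q d" and le: "\<And>t z. 0 \<le> t \<Longrightarrow> t \<le> 1 \<Longrightarrow> gap \<psi> t z d \<le> t * (1 - t) * c" for q d c
  proof -
    obtain t z where t: "0 < t" "t < 1" and q: "q = gap \<psi> t z d / (t * (1 - t))"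
      using q by (auto simp: Q_def)
    then have "0 < t * (1 - t)" by simp
    then show ?thesis using le[of t z] t by (simp add: q pos_divide_le_eq mult.commute)
  qed
  have bdd: "bdd_above (Q d)" for d
    using up[of _ d "L * norm d"] lip by (intro bdd_aboveI) blast
  have "gap \<psi> t z d \<le> t * (1 - t) * \<theta> d" if "0 \<le> t" "t \<le> 1" for t z d
  proof (cases "t = 0 \<or> t = 1")
    case True then show ?thesis by (auto simp: gap_def)
  next
    case False
    then have t: "0 < t" "t < 1" and tt: "0 < t * (1 - t)" using that by auto
    then have "gap \<psi> t z d / (t * (1 - t)) \<le> \<theta> d"
      unfolding \<theta>_def by (intro cSup_upper bdd) (auto simp: Q_def)
    then show ?thesis using tt by (simp add: pos_divide_le_eq mult.commute)
  qed
  moreover have "\<theta> d \<le> L * norm d" for d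
    unfolding \<theta>_def using up lip by (intro cSup_least ne) blast
  moreover have "\<exists>\<eta>>0. \<forall>d. norm d \<le> \<eta> \<longrightarrow> \<theta> d \<le> \<epsilon> * norm d" if "0 < \<epsilon>" for \<epsilon>
  proof -
    obtain \<eta> where "0 < \<eta>" and *: "\<And>t z d. 0 \<le> t \<Longrightarrow> t \<le> 1 \<Longrightarrow> norm d \<le> \<eta> \<Longrightarrow>
        gap \<psi> t z d \<le> t * (1 - t) * (\<epsilon> * norm d)" using small[OF \<open>0 < \<epsilon>\<close>] by blast
    have "\<theta> d \<le> \<epsilon> * norm d" if "norm d \<le> \<eta>" for d
      unfolding \<theta>_def using up * that by (intro cSup_least ne) blast
    then show ?thesis using \<open>0 < \<eta>\<close> by blast
  qed
  ultimately show ?thesis using that by blast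
qed

section \<open>Inserting a function that is semiconvex and semiconcave\<close>

text \<open>A version of Ilmanen's insertion lemma.  The envelope \<open>F\<close> is the supremum of all semiconvex functions
  below every \<open>g y\<close>.  The class of competitors is convex and invariant under translations, and this forces
  semiconcavity: \<open>(1 - t) F (x - t d) + t F (x + (1 - t) d) - t (1 - t) \<theta> d\<close>, as a function of \<open>x\<close>, is a
  competitor by the semiconcavity of each \<open>g y\<close>, hence lies below \<open>F\<close>.\<close>
lemma insertion_envelope:
  fixes g h :: "'i \<Rightarrow> 'a::real_normed_vector \<Rightarrow> real"
  assumes E: "e0 \<in> E"
    and g: "\<And>y t z d. y \<in> E \<Longrightarrow> 0 \<le> t \<Longrightarrow> t \<le> 1 \<Longrightarrow> gap (g y) t z d \<le> t * (1 - t) * \<theta> d"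
    and h: "\<And>y t z d. y \<in> E \<Longrightarrow> 0 \<le> t \<Longrightarrow> t \<le> 1 \<Longrightarrow> - (t * (1 - t) * \<theta> d) \<le> gap (h y) t z d"
    and hg: "\<And>y z x. y \<in> E \<Longrightarrow> z \<in> E \<Longrightarrow> h z x \<le> g y x"
  obtains F where
    "\<And>t z d. 0 \<le> t \<Longrightarrow> t \<le> 1 \<Longrightarrow> \<bar>gap F t z d\<bar> \<le> t * (1 - t) * \<theta> d"
    "\<And>y x. y \<in> E \<Longrightarrow> h y x \<le> F x" "\<And>y x. y \<in> E \<Longrightarrow> F x \<le> g y x"
proof -
  define P where "P = {u. (\<forall>t z d. 0 \<le> t \<longrightarrow> t \<le> 1 \<longrightarrow> - (t * (1 - t) * \<theta> d) \<le> gap u t z d) \<and>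
      (\<forall>y\<in>E. \<forall>x. u x \<le> g y x)}"
  have PI: "u \<in> P" if "\<And>t z d. 0 \<le> t \<Longrightarrow> t \<le> 1 \<Longrightarrow> u z \<le> (1 - t) * u (z - t *\<^sub>R d) + t * u (z + (1 - t) *\<^sub>R d) + t * (1 - t) * \<theta> d"
     "\<And>y x. y \<in> E \<Longrightarrow> u x \<le> g y x" for u
    using that by (fastforce simp: P_def gap_def algebra_simps)
  have P1: "u z \<le> (1 - t) * u (z - t *\<^sub>R d) + t * u (z + (1 - t) *\<^sub>R d) + t * (1 - t) * \<theta> d"
    if "u \<in> P" "0 \<le> t" "t \<le> 1" for u t z d
  proof -
    have "- (t * (1 - t) * \<theta> d) \<le> gap u t z d" using that by (simp add: P_def)
    then show ?thesis by (simp add: gap_def)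
  qed
  have P2: "u x \<le> g y x" if "u \<in> P" "y \<in> E" for u x y using that by (auto simp: P_def)
  have hP: "h y \<in> P" if "y \<in> E" for y using that h hg by (auto simp: P_def)
  define F where "F x = (SUP u\<in>P. u x)" for x
  have bdd: "bdd_above ((\<lambda>u. u x) ` P)" for x using P2 E by (intro bdd_aboveI2) blast
  have ne: "P \<noteq> {}" using hP E by blast
  have upper: "u x \<le> F x" if "u \<in> P" for u x
    unfolding F_def by (rule cSUP_upper[OF that bdd])
  have least: "F x \<le> c" if "\<And>u. u \<in> P \<Longrightarrow> u x \<le> c" for x c
    unfolding F_def by (rule cSUP_least[OF ne that])
  have FP: "F \<in> P"
  proof (rule PI)
    fix t :: real and z d :: 'a assume t: "0 \<le> t" "t \<le> 1"
    show "F z \<le> (1 - t) * F (z - t *\<^sub>R d) + t * F (z + (1 - t) *\<^sub>R d) + t * (1 - t) * \<theta> d"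
    proof (rule least)
      fix u assume u: "u \<in> P"
      have "(1 - t) * u (z - t *\<^sub>R d) + t * u (z + (1 - t) *\<^sub>R d)
          \<le> (1 - t) * F (z - t *\<^sub>R d) + t * F (z + (1 - t) *\<^sub>R d)"
        using upper[OF u] t by (intro add_mono mult_left_mono) auto
      then show "u z \<le> (1 - t) * F (z - t *\<^sub>R d) + t * F (z + (1 - t) *\<^sub>R d) + t * (1 - t) * \<theta> d"
        using P1[OF u t, of z d] by linarith
    qed
  qed (use least P2 in blast)
  have "gap F t z d \<le> t * (1 - t) * \<theta> d" if t: "0 \<le> t" "t \<le> 1" for t z d
  proof -
    define u where "u x = (1 - t) * F (x - t *\<^sub>R d) + t * F (x + (1 - t) *\<^sub>R d) - t * (1 - t) * \<theta> d" for x
    have "u \<in> P"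
    proof (rule PI)
      fix s :: real and x e :: 'a assume s: "0 \<le> s" "s \<le> 1"
      \<comment> \<open>The two displacements commute, so the semiconvexity of both translates of \<open>F\<close> can be averaged.\<close>
      have mono1: "(1 - t) * F (x - t *\<^sub>R d) \<le> (1 - t) * ((1 - s) * F ((x - t *\<^sub>R d) - s *\<^sub>R e)
            + s * F ((x - t *\<^sub>R d) + (1 - s) *\<^sub>R e) + s * (1 - s) * \<theta> e)"
        using P1[OF FP s] t by (intro mult_left_mono) auto
      have mono2: "t * F (x + (1 - t) *\<^sub>R d) \<le> t * ((1 - s) * F ((x + (1 - t) *\<^sub>R d) - s *\<^sub>R e)
            + s * F ((x + (1 - t) *\<^sub>R d) + (1 - s) *\<^sub>R e) + s * (1 - s) * \<theta> e)"
        using P1[OF FP s] t by (intro mult_left_mono) auto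
      have "(x - t *\<^sub>R d) - s *\<^sub>R e = (x - s *\<^sub>R e) - t *\<^sub>R d"
        "(x - t *\<^sub>R d) + (1 - s) *\<^sub>R e = (x + (1 - s) *\<^sub>R e) - t *\<^sub>R d"
        "(x + (1 - t) *\<^sub>R d) - s *\<^sub>R e = (x - s *\<^sub>R e) + (1 - t) *\<^sub>R d"
        "(x + (1 - t) *\<^sub>R d) + (1 - s) *\<^sub>R e = (x + (1 - s) *\<^sub>R e) + (1 - t) *\<^sub>R d"
        by (simp_all add: algebra_simps)
      note shift = this
      from add_mono[OF mono1 mono2, unfolded shift]
      have "u x \<le> (1 - t) * ((1 - s) * F ((x - s *\<^sub>R e) - t *\<^sub>R d)
            + s * F ((x + (1 - s) *\<^sub>R e) - t *\<^sub>R d) + s * (1 - s) * \<theta> e)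
          + t * ((1 - s) * F ((x - s *\<^sub>R e) + (1 - t) *\<^sub>R d)
            + s * F ((x + (1 - s) *\<^sub>R e) + (1 - t) *\<^sub>R d) + s * (1 - s) * \<theta> e) - t * (1 - t) * \<theta> d"
        unfolding u_def by (rule diff_right_mono)
      also have "\<dots> = (1 - s) * u (x - s *\<^sub>R e) + s * u (x + (1 - s) *\<^sub>R e) + s * (1 - s) * \<theta> e"
        unfolding u_def by algebra
      finally show "u x \<le> (1 - s) * u (x - s *\<^sub>R e) + s * u (x + (1 - s) *\<^sub>R e) + s * (1 - s) * \<theta> e" .
    next
      fix y x assume y: "y \<in> E"
      have "(1 - t) * F (x - t *\<^sub>R d) + t * F (x + (1 - t) *\<^sub>R d)
          \<le> (1 - t) * g y (x - t *\<^sub>R d) + t * g y (x + (1 - t) *\<^sub>R d)"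
        using P2[OF FP y] t by (intro add_mono mult_left_mono) auto
      then show "u x \<le> g y x" using g[OF y t, of x d] by (simp add: u_def gap_def)
    qed
    then have "u z \<le> F z" by (rule upper)
    then show ?thesis by (simp add: u_def gap_def)
  qed
  moreover have "- (t * (1 - t) * \<theta> d) \<le> gap F t z d" if "0 \<le> t" "t \<le> 1" for t z d
    using P1[OF FP that, of z d] by (simp add: gap_def)
  ultimately have "\<bar>gap F t z d\<bar> \<le> t * (1 - t) * \<theta> d" if "0 \<le> t" "t \<le> 1" for t z d
    using that by (simp add: abs_le_iff minus_le_iff)
  then show ?thesis using that upper hP P2 FP by blast
qed

section \<open>Two-sided gap bounds imply uniform differentiability\<close>

text \<open>A globally Lipschitz version of \<open>C1plus UNIV\<close>.  Bounded derivatives make products of two members well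
  behaved on bounded sets, which the partition of unity needs.\<close>
definition lipschitz_C1plus :: "('a::real_normed_vector \<Rightarrow> real) set" where
  "lipschitz_C1plus = {F. \<exists>D :: 'a \<Rightarrow> ('a \<Rightarrow>\<^sub>L real).
     (\<forall>x. (F has_derivative blinfun_apply (D x)) (at x)) \<and>
     uniformly_continuous_on UNIV D \<and> bounded (range D)}"

lemma lipschitz_C1plusI:
  assumes "\<And>x. (F has_derivative blinfun_apply (D x)) (at x)" "uniformly_continuous_on UNIV D" "bounded (range D)"
  shows "F \<in> lipschitz_C1plus"
  unfolding lipschitz_C1plus_def using assms by (intro CollectI exI[of _ D]) simp

text \<open>Applied with end points \<open>x\<close> and \<open>x + t v\<close>, the gap bound compares the difference quotients at \<open>s \<le> t\<close>:
  they differ by at most \<open>\<theta> (t v) / t\<close>, which tends to 0.  So one-sided directional derivatives exist,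
  with a remainder \<open>\<theta>\<close> that does not depend on the base point.  The midpoint case \<open>t = 1/2\<close> makes
  them additive, local boundedness makes them continuous, and the uniform remainder controls the
  oscillation of the derivative.\<close>
lemma small_gap_imp_C1:
  fixes F :: "'a::real_normed_vector \<Rightarrow> real"
  assumes gap: "\<And>t z d. 0 \<le> t \<Longrightarrow> t \<le> 1 \<Longrightarrow> \<bar>gap F t z d\<bar> \<le> t * (1 - t) * \<theta> d"
    and lip: "\<And>d. \<theta> d \<le> L * norm d"
    and small: "\<And>\<epsilon>. 0 < \<epsilon> \<Longrightarrow> \<exists>\<eta>>0. \<forall>d. norm d \<le> \<eta> \<longrightarrow> \<theta> d \<le> \<epsilon> * norm d"
    and bdd: "\<And>x. \<exists>B. \<forall>v. norm v \<le> 1 \<longrightarrow> \<bar>F (x + v)\<bar> \<le> B"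
  shows "F \<in> lipschitz_C1plus"
proof -
  have \<theta>0: "0 \<le> \<theta> d" for d using gap[of "1 / 2" 0 d] by simp
  have \<theta>_lim: "((\<lambda>s. \<theta> (s *\<^sub>R u) / s) \<longlongrightarrow> 0) (at_right 0)" for u
  proof (rule tendstoI)
    fix e :: real assume e: "0 < e"
    define \<epsilon> where "\<epsilon> = e / (norm u + 1)"
    have nu: "0 < norm u + 1" by (simp add: add_nonneg_pos)
    have "0 < \<epsilon>" using e nu by (simp add: \<epsilon>_def)
    then obtain \<eta> where \<eta>: "0 < \<eta>" "\<And>d. norm d \<le> \<eta> \<Longrightarrow> \<theta> d \<le> \<epsilon> * norm d" using small by blast
    have "\<forall>\<^sub>F s in at_right 0. s < \<eta> / (norm u + 1)"
      using \<eta> nu by (intro order_tendstoD(2)[OF tendsto_ident_at]) (simp add: divide_pos_pos)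
    moreover have "\<forall>\<^sub>F s in at_right (0::real). 0 < s" by (rule eventually_at_right_less)
    ultimately show "\<forall>\<^sub>F s in at_right 0. dist (\<theta> (s *\<^sub>R u) / s) 0 < e"
    proof eventually_elim
      case (elim s)
      have "s * (norm u + 1) < \<eta>" using elim nu by (simp add: pos_less_divide_eq)
      moreover have "s * norm u \<le> s * (norm u + 1)" using elim by (intro mult_left_mono) auto
      ultimately have "s * norm u \<le> \<eta>" by linarith
      then have "norm (s *\<^sub>R u) \<le> \<eta>" using elim by simp
      then have "\<theta> (s *\<^sub>R u) \<le> \<epsilon> * (s * norm u)" using \<eta>(2)[of "s *\<^sub>R u"] elim by simp
      then have "\<theta> (s *\<^sub>R u) / s \<le> \<epsilon> * norm u" using elim by (simp add: pos_divide_le_eq mult_ac)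
      also have "\<dots> < \<epsilon> * (norm u + 1)" using \<open>0 < \<epsilon>\<close> by simp
      also have "\<dots> = e" using nu by (simp add: \<epsilon>_def)
      finally show ?case using \<theta>0[of "s *\<^sub>R u"] elim by (simp add: dist_real_def)
    qed
  qed
  define q where "q x v t = (F (x + t *\<^sub>R v) - F x) / t" for x v t
  have q_diff: "\<bar>q x v t - q x v s\<bar> \<le> \<theta> (t *\<^sub>R v) / t" if s: "0 < s" "s \<le> t" for x v s t
  proof -
    define l where "l = s / t"
    have l: "0 \<le> l" "l \<le> 1" and lt: "l * t = s" and t: "0 < t" using s by (auto simp: l_def)
    have 1: "x + s *\<^sub>R v - l *\<^sub>R (t *\<^sub>R v) = x" using lt by simp
    have 2: "x + s *\<^sub>R v + (1 - l) *\<^sub>R (t *\<^sub>R v) = x + t *\<^sub>R v"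
      using lt by (simp add: algebra_simps)
    have "gap F l (x + s *\<^sub>R v) (t *\<^sub>R v) = (1 - l) * F x + l * F (x + t *\<^sub>R v) - F (x + s *\<^sub>R v)"
      unfolding gap_def 1 2 ..
    also have "\<dots> = s * (q x v t - q x v s)"
      using s t by (simp add: q_def l_def field_simps)
    finally have "s * \<bar>q x v t - q x v s\<bar> \<le> l * (1 - l) * \<theta> (t *\<^sub>R v)"
      using gap[OF l, of "x + s *\<^sub>R v" "t *\<^sub>R v"] s by (simp add: abs_mult)
    also have "\<dots> \<le> l * \<theta> (t *\<^sub>R v)"
      using l \<theta>0 by (intro mult_right_mono) (auto simp: mult_left_le)
    also have "\<dots> = s * (\<theta> (t *\<^sub>R v) / t)" by (simp add: l_def)
    finally show ?thesis using s by (simp only: mult_le_cancel_left_pos)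
  qed
  define r where "r n = inverse (real (Suc n))" for n
  have r_pos: "0 < r n" for n by (simp add: r_def)
  have r_mono: "r n \<le> r M" if "M \<le> n" for n M
    using that by (simp add: r_def)
  have r_less: "\<exists>M. r M < b" if "0 < b" for b
    unfolding r_def by (rule reals_Archimedean[OF that])
  \<comment> \<open>The one-sided derivative; the sequence \<open>r\<close> merely discretises \<open>s \<rightarrow> 0+\<close>.\<close>
  define L' where "L' x v = lim (\<lambda>n. q x v (r n))" for x v
  have q_lim: "(\<lambda>n. q x v (r n)) \<longlonglongrightarrow> L' x v" for x v
  proof -
    have "Cauchy (\<lambda>n. q x v (r n))"
    proof (rule metric_CauchyI)
      fix e :: real assume e: "0 < e"
      have "\<forall>\<^sub>F s in at_right 0. \<theta> (s *\<^sub>R v) / s < e / 2"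
        by (rule order_tendstoD(2)[OF \<theta>_lim]) (use e in simp)
      then obtain b where b: "0 < b" "\<And>s. 0 < s \<Longrightarrow> s < b \<Longrightarrow> \<theta> (s *\<^sub>R v) / s < e / 2"
        unfolding eventually_at_right_field by auto
      obtain M where M: "r M < b" using r_less[OF b(1)] by blast
      have "dist (q x v (r i)) (q x v (r j)) < e" if "M \<le> i" "M \<le> j" for i j
      proof -
        have "\<theta> (r M *\<^sub>R v) / r M < e / 2" using b(2)[OF r_pos M] .
        then have "\<bar>q x v (r M) - q x v (r i)\<bar> < e / 2" "\<bar>q x v (r M) - q x v (r j)\<bar> < e / 2"
          using q_diff[OF r_pos r_mono[OF that(1)], of x v] q_diff[OF r_pos r_mono[OF that(2)], of x v]
          by linarith+
        then show ?thesis unfolding dist_real_def by linarith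
      qed
      then show "\<exists>M. \<forall>i\<ge>M. \<forall>j\<ge>M. dist (q x v (r i)) (q x v (r j)) < e" by blast
    qed
    then show ?thesis
      unfolding L'_def by (simp only: Cauchy_convergent_iff convergent_LIMSEQ_iff)
  qed
  have rem: "\<bar>F (x + t *\<^sub>R v) - F x - t * L' x v\<bar> \<le> \<theta> (t *\<^sub>R v)" if t: "0 < t" for x v t
  proof -
    obtain M where M: "r M < t" using r_less[OF t] by blast
    have "\<bar>q x v t - q x v (r n)\<bar> \<le> \<theta> (t *\<^sub>R v) / t" if "M \<le> n" for n
      using r_mono[OF that] M by (intro q_diff r_pos) linarith
    then have "\<bar>q x v t - L' x v\<bar> \<le> \<theta> (t *\<^sub>R v) / t"
      by (intro tendsto_upperbound[OF tendsto_rabs[OF tendsto_diff[OF tendsto_const q_lim]]]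
          eventually_sequentiallyI[of M]) auto
    then have "t * \<bar>q x v t - L' x v\<bar> \<le> \<theta> (t *\<^sub>R v)" using t by (simp add: pos_le_divide_eq mult.commute)
    then have "\<bar>t * (q x v t - L' x v)\<bar> \<le> \<theta> (t *\<^sub>R v)" using t by (simp add: abs_mult)
    moreover have "t * (q x v t - L' x v) = F (x + t *\<^sub>R v) - F x - t * L' x v"
      using t by (simp add: q_def field_simps)
    ultimately show ?thesis by simp
  qed
  \<comment> \<open>A number that is \<open>o(s) / s\<close> vanishes; four error terms are what additivity below produces.\<close>
  have zeroI: "A = 0" if "\<And>s. 0 < s \<Longrightarrow> s * \<bar>A\<bar> \<le> \<theta> (s *\<^sub>R u1) + \<theta> (s *\<^sub>R u2) + \<theta> (s *\<^sub>R u3) + \<theta> (s *\<^sub>R u4)"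
    for A u1 u2 u3 u4
  proof -
    have "((\<lambda>s. \<theta> (s *\<^sub>R u1) / s + \<theta> (s *\<^sub>R u2) / s + \<theta> (s *\<^sub>R u3) / s + \<theta> (s *\<^sub>R u4) / s) \<longlongrightarrow> 0 + 0 + 0 + 0) (at_right 0)"
      by (intro tendsto_add \<theta>_lim)
    moreover have "\<forall>\<^sub>F s in at_right 0. \<bar>A\<bar> \<le> \<theta> (s *\<^sub>R u1) / s + \<theta> (s *\<^sub>R u2) / s + \<theta> (s *\<^sub>R u3) / s + \<theta> (s *\<^sub>R u4) / s"
      using eventually_at_right_less[of "0::real"]
    proof eventually_elim
      case (elim s)
      then show ?case using that[OF elim]
        by (simp add: add_divide_distrib[symmetric] pos_le_divide_eq mult.commute)
    qed
    ultimately have "\<bar>A\<bar> \<le> 0 + 0 + 0 + 0" by (rule tendsto_lowerbound) simp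
    then show ?thesis by simp
  qed
  have add: "L' x (v + w) = L' x v + L' x w" for x v w
  proof -
    have "L' x v + L' x w - L' x (v + w) = 0"
    proof (rule zeroI[of _ "2 *\<^sub>R v" "2 *\<^sub>R w" "v + w" "2 *\<^sub>R (w - v)"])
      fix s :: real assume s: "0 < s"
      have tw: "(2 * s) *\<^sub>R u = s *\<^sub>R u + s *\<^sub>R u" for u :: 'a
        by (simp only: mult_2 scaleR_add_left)
      have 1: "x + s *\<^sub>R (v + w) - (1 / 2) *\<^sub>R (s *\<^sub>R (2 *\<^sub>R (w - v))) = x + (2 * s) *\<^sub>R v"
        unfolding tw by (simp add: algebra_simps)
      have 2: "x + s *\<^sub>R (v + w) + (1 - 1 / 2) *\<^sub>R (s *\<^sub>R (2 *\<^sub>R (w - v))) = x + (2 * s) *\<^sub>R w"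
        unfolding tw by (simp add: algebra_simps)
      have "\<bar>F (x + (2 * s) *\<^sub>R v) / 2 + F (x + (2 * s) *\<^sub>R w) / 2 - F (x + s *\<^sub>R (v + w))\<bar>
          \<le> \<theta> (s *\<^sub>R (2 *\<^sub>R (w - v))) / 4"
        using gap[of "1 / 2" "x + s *\<^sub>R (v + w)" "s *\<^sub>R (2 *\<^sub>R (w - v))"] unfolding gap_def 1 2 by simp
      moreover have "\<bar>F (x + (2 * s) *\<^sub>R v) - F x - (2 * s) * L' x v\<bar> \<le> \<theta> (s *\<^sub>R (2 *\<^sub>R v))"
        "\<bar>F (x + (2 * s) *\<^sub>R w) - F x - (2 * s) * L' x w\<bar> \<le> \<theta> (s *\<^sub>R (2 *\<^sub>R w))"
        "\<bar>F (x + s *\<^sub>R (v + w)) - F x - s * L' x (v + w)\<bar> \<le> \<theta> (s *\<^sub>R (v + w))"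
        using rem[of "2 * s" x v] rem[of "2 * s" x w] rem[of s x "v + w"] s by (simp_all add: mult.commute)
      moreover have "s * \<bar>L' x v + L' x w - L' x (v + w)\<bar> = \<bar>s * L' x v + s * L' x w - s * L' x (v + w)\<bar>"
      proof -
        have "s * L' x v + s * L' x w - s * L' x (v + w) = s * (L' x v + L' x w - L' x (v + w))"
          by (simp add: algebra_simps)
        then show ?thesis using s by (simp only: abs_mult abs_of_pos)
      qed
      ultimately show "s * \<bar>L' x v + L' x w - L' x (v + w)\<bar> \<le> \<theta> (s *\<^sub>R (2 *\<^sub>R v)) + \<theta> (s *\<^sub>R (2 *\<^sub>R w))
          + \<theta> (s *\<^sub>R (v + w)) + \<theta> (s *\<^sub>R (2 *\<^sub>R (w - v)))"
        using \<theta>0[of "s *\<^sub>R (2 *\<^sub>R (w - v))"] \<theta>0[of "s *\<^sub>R (2 *\<^sub>R v)"] \<theta>0[of "s *\<^sub>R (2 *\<^sub>R w)"] by linarith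
    qed
    then show ?thesis by simp
  qed
  have pos_hom: "L' x (c *\<^sub>R v) = c * L' x v" if c: "0 < c" for x v c
  proof -
    have "L' x (c *\<^sub>R v) - c * L' x v = 0"
    proof (rule zeroI[of _ "c *\<^sub>R v" "c *\<^sub>R v" 0 0])
      fix s :: real assume s: "0 < s"
      have "s * \<bar>L' x (c *\<^sub>R v) - c * L' x v\<bar> = \<bar>s * L' x (c *\<^sub>R v) - (s * c) * L' x v\<bar>"
      proof -
        have "s * L' x (c *\<^sub>R v) - (s * c) * L' x v = s * (L' x (c *\<^sub>R v) - c * L' x v)"
          by (simp add: algebra_simps)
        then show ?thesis using s by (simp only: abs_mult abs_of_pos)
      qed
      then show "s * \<bar>L' x (c *\<^sub>R v) - c * L' x v\<bar>
          \<le> \<theta> (s *\<^sub>R (c *\<^sub>R v)) + \<theta> (s *\<^sub>R (c *\<^sub>R v)) + \<theta> (s *\<^sub>R 0) + \<theta> (s *\<^sub>R 0)"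
        using rem[of s x "c *\<^sub>R v"] rem[of "s * c" x v] s c \<theta>0[of "s *\<^sub>R 0"] by simp
    qed
    then show ?thesis by simp
  qed
  have L0: "L' x 0 = 0" for x using add[of x 0 0] by simp
  have hom: "L' x (c *\<^sub>R v) = c * L' x v" for x v c
  proof (cases c "0 :: real" rule: linorder_cases)
    case less
    have "L' x (c *\<^sub>R v) + L' x (- c *\<^sub>R v) = 0" using add[of x "c *\<^sub>R v" "- c *\<^sub>R v"] L0 by simp
    then show ?thesis using pos_hom[of "- c" x v] less by simp
  qed (auto simp: L0 pos_hom)
  have bl: "bounded_linear (L' x)" for x
  proof -
    obtain B where B: "\<And>v. norm v \<le> 1 \<Longrightarrow> \<bar>F (x + v)\<bar> \<le> B" using bdd by blast
    have unit: "\<bar>L' x v\<bar> \<le> B + \<bar>F x\<bar> + \<bar>L\<bar>" if "norm v \<le> 1" for v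
    proof -
      have "L * norm v \<le> \<bar>L\<bar> * 1" using that by (intro mult_mono) auto
      then have "\<theta> v \<le> \<bar>L\<bar>" using lip[of v] by simp
      then show ?thesis using rem[of 1 x v] B[OF that] by simp
    qed
    show ?thesis
    proof (rule bounded_linear_intro[OF add])
      show "L' x (c *\<^sub>R v) = c *\<^sub>R L' x v" for c v by (simp add: hom)
      show "norm (L' x v) \<le> norm v * (B + \<bar>F x\<bar> + \<bar>L\<bar>)" for v
      proof (cases "v = 0")
        case False
        have "\<bar>L' x (inverse (norm v) *\<^sub>R v)\<bar> \<le> B + \<bar>F x\<bar> + \<bar>L\<bar>" using False by (intro unit) simp
        then show ?thesis using False by (simp add: hom abs_mult field_simps)
      qed (simp add: L0)
    qed
  qed
  define D where "D x = Blinfun (L' x)" for x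
  have D: "blinfun_apply (D x) = L' x" for x by (simp add: D_def bounded_linear_Blinfun_apply bl)
  have rem1: "\<bar>F (x + v) - F x - D x v\<bar> \<le> \<theta> v" for x v
    using rem[of 1 x v] by (simp add: D)
  have "(F has_derivative D x) (at x)" for x
    unfolding has_derivative_at
  proof (intro conjI LIM_I)
    show "bounded_linear (D x)" by (rule blinfun.bounded_linear_right)
    fix e :: real assume e: "0 < e"
    then obtain \<eta> where \<eta>: "0 < \<eta>" "\<And>d. norm d \<le> \<eta> \<Longrightarrow> \<theta> d \<le> e / 2 * norm d"
      using small[of "e / 2"] by auto
    have "norm (norm (F (x + h) - F x - D x h) / norm h - 0) < e" if "h \<noteq> 0" "norm (h - 0) < \<eta>" for h
    proof -
      have "\<bar>F (x + h) - F x - D x h\<bar> \<le> e / 2 * norm h" using rem1[of x h] \<eta>(2)[of h] that by simp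
      then have "\<bar>F (x + h) - F x - D x h\<bar> / norm h \<le> e / 2" using that by (simp add: pos_divide_le_eq)
      then have "\<bar>F (x + h) - F x - D x h\<bar> / norm h < e" using e by linarith
      then show ?thesis by simp
    qed
    then show "\<exists>s>0. \<forall>h. h \<noteq> 0 \<and> norm (h - 0) < s \<longrightarrow>
        norm (norm (F (x + h) - F x - D x h) / norm h - 0) < e" using \<eta>(1) by blast
  qed
  \<comment> \<open>Expand \<open>F (x + w + v)\<close> around \<open>x\<close> in one step and around \<open>x + w\<close> after a first step; the choice
    \<open>norm v = norm w\<close> keeps all three remainders proportional to \<open>norm v\<close>.\<close>
  moreover have D_diff: "norm (D (x + w) - D x) \<le> 4 * c"
    if c: "0 \<le> c" and \<theta>c: "\<And>d. norm d \<le> 2 * norm w \<Longrightarrow> \<theta> d \<le> c * norm d" for x w c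
  proof (cases "w = 0")
    case False
    have same: "\<bar>D (x + w) v - D x v\<bar> \<le> 4 * c * norm w" if v: "norm v = norm w" for v
    proof -
      have vw: "norm (v + w) \<le> 2 * norm w" using norm_triangle_ineq[of v w] v by simp
      have "\<theta> (v + w) \<le> c * (2 * norm w)" "\<theta> v \<le> c * norm w" "\<theta> w \<le> c * norm w"
        using order_trans[OF \<theta>c[OF vw] mult_left_mono[OF vw c]] \<theta>c[of v] \<theta>c[of w] v by auto
      moreover have "D x (v + w) = D x v + D x w" by (rule blinfun.add_right)
      ultimately show ?thesis
        using rem1[of x "v + w"] rem1[of "x + w" v] rem1[of x w] by (simp add: add_ac)
    qed
    show ?thesis
    proof (rule norm_blinfun_bound)
      fix u
      show "norm ((D (x + w) - D x) u) \<le> 4 * c * norm u"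
      proof (cases "u = 0")
        case u: False
        define k where "k = norm w / norm u"
        have k: "0 < k" using u False by (simp add: k_def)
        have "\<bar>D (x + w) (k *\<^sub>R u) - D x (k *\<^sub>R u)\<bar> \<le> 4 * c * norm w"
          using u by (intro same) (simp add: k_def)
        then have "k * \<bar>D (x + w) u - D x u\<bar> \<le> 4 * c * norm w"
          using k by (simp add: blinfun.scaleR_right right_diff_distrib[symmetric] abs_mult)
        also have "\<dots> = k * (4 * c * norm u)" using u by (simp add: k_def)
        finally show ?thesis using k by (simp add: blinfun.diff_left)
      qed simp
    qed (use c in simp)
  qed (use c in simp)
  have "uniformly_continuous_on UNIV D"
    unfolding uniformly_continuous_on_def
  proof (intro allI impI)
    fix e :: real assume e: "0 < e"
    then obtain \<eta> where \<eta>: "0 < \<eta>" "\<And>d. norm d \<le> \<eta> \<Longrightarrow> \<theta> d \<le> e / 8 * norm d"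
      using small[of "e / 8"] by auto
    have "dist (D y) (D x) < e" if "dist y x < \<eta> / 2" for x y
    proof -
      have "norm (D (x + (y - x)) - D x) \<le> 4 * (e / 8)"
        using that e by (intro D_diff \<eta>(2)) (auto simp: dist_norm)
      then show ?thesis using e by (simp add: dist_norm)
    qed
    then show "\<exists>d>0. \<forall>x\<in>UNIV. \<forall>x'\<in>UNIV. dist x' x < d \<longrightarrow> dist (D x') (D x) < e"
      using \<eta>(1) half_gt_zero by blast
  qed
  moreover have "bounded (range D)"
  proof (rule boundedI)
    fix y assume "y \<in> range D"
    then obtain x where y: "y = D x" by blast
    have "norm (D (0 + x) - D 0) \<le> 4 * \<bar>L\<bar>"
    proof (rule D_diff)
      fix d show "\<theta> d \<le> \<bar>L\<bar> * norm d"
        using lip[of d] mult_right_mono[OF abs_ge_self[of L] norm_ge_zero[of d]] by linarith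
    qed simp
    then show "norm y \<le> norm (D 0) + 4 * \<bar>L\<bar>"
      using norm_triangle_ineq2[of "D x" "D 0"] by (simp add: y)
  qed
  ultimately show ?thesis by (rule lipschitz_C1plusI)
qed

section \<open>Whitney extension of first order jets\<close>

text \<open>Affine functions have no gap.\<close>
lemma gap_affine_add:
  fixes A :: "'a::real_normed_vector \<Rightarrow>\<^sub>L real"
  shows "gap (\<lambda>x. c + A (x - y) + u (x - y)) t z d = gap u t (z - y) d"
    and "gap (\<lambda>x. c + A (x - y) - u (x - y)) t z d = - gap u t (z - y) d"
  by (simp_all add: gap_def blinfun.add_right blinfun.diff_right blinfun.scaleR_right
      diff_add_eq diff_right_commute algebra_simps)

text \<open>\<open>E\<close> is arbitrary.  The two hypotheses are Whitney's compatibility conditions with a bounded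
  modulus; boundedness is what a gauge of linear growth can dominate.  The comparison of the two families,
  \<open>hg\<close>, is the only place where they are used: the difference \<open>R\<close> of the two affine parts at \<open>x\<close> is at
  most \<open>3 e s\<close>, where \<open>s\<close> is the larger distance from \<open>x\<close> to \<open>y\<close>, \<open>z\<close> and \<open>e\<close> bounds the remainders at
  distance \<open>2 s\<close>.\<close>
theorem whitney_extension:
  fixes f :: "'a::banach \<Rightarrow> real" and G :: "'a \<Rightarrow> 'a \<Rightarrow>\<^sub>L real"
  assumes sr: "super_reflexive TYPE('a)"
    and K: "\<And>x y. x \<in> E \<Longrightarrow> y \<in> E \<Longrightarrow>
      norm (G x - G y) \<le> K \<and> \<bar>f x - f y - G y (x - y)\<bar> \<le> K * norm (x - y)"
    and small: "\<And>\<epsilon>. 0 < \<epsilon> \<Longrightarrow> \<exists>\<delta>>0. \<forall>x\<in>E. \<forall>y\<in>E. norm (x - y) \<le> \<delta> \<longrightarrow>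
      norm (G x - G y) \<le> \<epsilon> \<and> \<bar>f x - f y - G y (x - y)\<bar> \<le> \<epsilon> * norm (x - y)"
  shows "\<exists>F\<in>lipschitz_C1plus. \<forall>x\<in>E. F x = f x"
proof (cases "E = {}")
  case True
  have "(\<lambda>x::'a. 0) \<in> lipschitz_C1plus"
    by (rule lipschitz_C1plusI[of _ "\<lambda>x. 0"])
      (auto simp: zero_blinfun.rep_eq uniformly_continuous_on_const)
  then show ?thesis using True by blast
next
  case False
  then obtain e0 where e0: "e0 \<in> E" by blast
  define K' where "K' = max K 1"
  have K'0: "0 < K'" by (simp add: K'_def)
  have "\<exists>\<delta>>0. \<forall>x\<in>E. \<forall>y\<in>E. norm (x - y) \<le> 2 * \<delta> \<longrightarrow>
      norm (G x - G y) \<le> K' / 2 ^ k \<and> \<bar>f x - f y - G y (x - y)\<bar> \<le> K' / 2 ^ k * norm (x - y)" for k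
  proof -
    have "0 < K' / 2 ^ k" using K'0 by simp
    from small[OF this] obtain \<delta> where "\<delta> > 0" and \<delta>: "\<forall>x\<in>E. \<forall>y\<in>E. norm (x - y) \<le> \<delta> \<longrightarrow>
      norm (G x - G y) \<le> K' / 2 ^ k \<and> \<bar>f x - f y - G y (x - y)\<bar> \<le> K' / 2 ^ k * norm (x - y)" by blast
    then show ?thesis by (intro exI[of _ "\<delta> / 2"]) auto
  qed
  then obtain \<delta> :: "nat \<Rightarrow> real" where \<delta>0: "\<And>k. 0 < \<delta> k"
    and \<delta>: "\<And>k x y. x \<in> E \<Longrightarrow> y \<in> E \<Longrightarrow> norm (x - y) \<le> 2 * \<delta> k \<Longrightarrow>
      norm (G x - G y) \<le> K' / 2 ^ k \<and> \<bar>f x - f y - G y (x - y)\<bar> \<le> K' / 2 ^ k * norm (x - y)"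
    by metis
  have C0: "0 < 6 * K'" using K'0 by simp
  obtain \<psi> :: "'a \<Rightarrow> real" and L where \<psi>_0: "\<psi> 0 = 0" and \<psi>_nn: "\<And>x. 0 \<le> \<psi> x"
    and \<psi>_ge: "\<And>k x. \<delta> k \<le> norm x \<Longrightarrow> (6 * K') / 2 ^ k * norm x \<le> \<psi> x"
    and \<psi>_lip: "\<And>t z d. 0 \<le> t \<Longrightarrow> t \<le> 1 \<Longrightarrow> gap \<psi> t z d \<le> t * (1 - t) * (L * norm d)"
    and \<psi>_small: "\<And>\<epsilon>. 0 < \<epsilon> \<Longrightarrow> \<exists>\<eta>>0. \<forall>t z d. 0 \<le> t \<longrightarrow> t \<le> 1 \<longrightarrow> norm d \<le> \<eta> \<longrightarrow>
        gap \<psi> t z d \<le> t * (1 - t) * (\<epsilon> * norm d)"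
    using smooth_gauge_exists[where \<delta> = \<delta> and C = "6 * K'", OF sr \<delta>0 C0] by blast
  obtain \<theta> where \<theta>: "\<And>t z d. 0 \<le> t \<Longrightarrow> t \<le> 1 \<Longrightarrow> gap \<psi> t z d \<le> t * (1 - t) * \<theta> d"
    and \<theta>_lip: "\<And>d. \<theta> d \<le> L * norm d"
    and \<theta>_small: "\<And>\<epsilon>. 0 < \<epsilon> \<Longrightarrow> \<exists>\<eta>>0. \<forall>d. norm d \<le> \<eta> \<longrightarrow> \<theta> d \<le> \<epsilon> * norm d"
    using gap_modulus_exists[OF \<psi>_lip \<psi>_small] by blast
  define g where "g y = (\<lambda>x. f y + G y (x - y) + \<psi> (x - y))" for y
  define h where "h y = (\<lambda>x. f y + G y (x - y) - \<psi> (x - y))" for y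
  have hg: "h z x \<le> g y x" if y: "y \<in> E" and z: "z \<in> E" for y z x
  proof -
    define s where "s = max (norm (x - z)) (norm (x - y))"
    define R where "R = (f z + G z (x - z)) - (f y + G y (x - y))"
    have s0: "0 \<le> s" by (simp add: s_def le_max_iff_disj)
    have zy: "norm (z - y) \<le> 2 * s"
      using norm_triangle_ineq4[of "x - y" "x - z"] by (simp add: s_def)
    have R_le: "R \<le> 3 * e * s" if e: "norm (G z - G y) \<le> e" "\<bar>f z - f y - G y (z - y)\<bar> \<le> e * norm (z - y)" for e
    proof -
      have "0 \<le> e" using e(1) norm_ge_zero order_trans by blast
      have "x - y = (z - y) + (x - z)" by simp
      then have "G y (x - y) = G y (z - y) + G y (x - z)" by (metis blinfun.add_right)
      then have "R = (f z - f y - G y (z - y)) + (G z - G y) (x - z)"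
        by (simp add: R_def blinfun.diff_left)
      also have "\<dots> \<le> e * norm (z - y) + norm (G z - G y) * norm (x - z)"
        using e(2) norm_blinfun[of "G z - G y" "x - z"] by (intro add_mono) auto
      also have "\<dots> \<le> e * (2 * s) + e * s"
        using zy e(1) \<open>0 \<le> e\<close> by (intro add_mono mult_mono) (auto simp: s_def)
      finally show ?thesis by (simp add: mult_ac)
    qed
    have P: "6 * K' / 2 ^ k * s \<le> \<psi> (x - z) + \<psi> (x - y)" if "\<delta> k \<le> s" for k
    proof (cases "norm (x - y) \<le> norm (x - z)")
      case True
      then show ?thesis using \<psi>_ge[of k "x - z"] that \<psi>_nn[of "x - y"] by (simp add: s_def max_def)
    next
      case False
      then show ?thesis using \<psi>_ge[of k "x - y"] that \<psi>_nn[of "x - z"] by (simp add: s_def max_def)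
    qed
    have R0: "R \<le> 3 * K' * s"
    proof (rule R_le)
      show "norm (G z - G y) \<le> K'" using K[OF z y] by (simp add: K'_def le_max_iff_disj)
      have "K * norm (z - y) \<le> K' * norm (z - y)" by (intro mult_right_mono) (auto simp: K'_def)
      then show "\<bar>f z - f y - G y (z - y)\<bar> \<le> K' * norm (z - y)" using K[OF z y] by linarith
    qed
    have Rk: "R \<le> 3 * (K' / 2 ^ k) * s" if "s \<le> \<delta> k" for k
      using \<delta>[OF z y, of k] zy that by (intro R_le) auto
    have "R \<le> \<psi> (x - z) + \<psi> (x - y)"
    proof (cases "\<exists>k. \<delta> k \<le> s")
      case True
      \<comment> \<open>At this \<open>k\<close> the gauge of level \<open>k\<close> must beat the remainders of level \<open>k - 1\<close>, which are twice as
        large; hence the factor 6 instead of 3 in \<open>\<psi>\<close>.\<close>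
      define k where "k = (LEAST k. \<delta> k \<le> s)"
      have k: "\<delta> k \<le> s" unfolding k_def using True by (rule LeastI_ex)
      show ?thesis
      proof (cases k)
        case 0
        have "3 * K' * s \<le> 6 * K' * s" using K'0 s0 by (intro mult_right_mono) auto
        then show ?thesis using R0 P[OF k] 0 by simp
      next
        case (Suc j)
        then have "s \<le> \<delta> j" using not_less_Least[of j "\<lambda>k. \<delta> k \<le> s"] by (simp add: k_def)
        then show ?thesis using Rk[of j] P[OF k] Suc by simp
      qed
    next
      case False
      have "R \<le> 0"
      proof (rule ccontr)
        assume "\<not> R \<le> 0"
        then have R: "0 < R" by simp
        obtain n where "3 * K' * s / R < 2 ^ n" using real_arch_pow[of 2 "3 * K' * s / R"] by auto
        then have "3 * (K' / 2 ^ n) * s < R" using R by (simp add: field_simps)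
        moreover have "s \<le> \<delta> n" using False not_le by (metis less_imp_le)
        ultimately show False using Rk[of n] by linarith
      qed
      then show ?thesis using \<psi>_nn[of "x - z"] \<psi>_nn[of "x - y"] by linarith
    qed
    then show ?thesis by (simp add: R_def g_def h_def)
  qed
  have gap_g: "gap (g y) t z d \<le> t * (1 - t) * \<theta> d" if "0 \<le> t" "t \<le> 1" for y t z d
    unfolding g_def gap_affine_add(1) by (rule \<theta>[OF that])
  have gap_h: "- (t * (1 - t) * \<theta> d) \<le> gap (h y) t z d" if "0 \<le> t" "t \<le> 1" for y t z d
    unfolding h_def gap_affine_add(2) using \<theta>[OF that, of "z - y" d] by simp
  obtain F where F: "\<And>t z d. 0 \<le> t \<Longrightarrow> t \<le> 1 \<Longrightarrow> \<bar>gap F t z d\<bar> \<le> t * (1 - t) * \<theta> d"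
    and hF: "\<And>y x. y \<in> E \<Longrightarrow> h y x \<le> F x" and Fg: "\<And>y x. y \<in> E \<Longrightarrow> F x \<le> g y x"
    using insertion_envelope[where E = E and g = g and h = h and \<theta> = \<theta>, OF e0 gap_g gap_h hg] by blast
  \<comment> \<open>At \<open>z = 0\<close>, \<open>t = 1/2\<close> the gap of \<open>\<psi>\<close> is a mean of two nonnegative values of \<open>\<psi>\<close>.\<close>
  have \<psi>_le: "\<psi> u \<le> \<bar>L\<bar> * norm u" for u
  proof -
    have "\<psi> u / 2 \<le> 1 / 4 * (L * (2 * norm u))"
      using \<psi>_lip[of "1 / 2" 0 "2 *\<^sub>R u"] \<psi>_nn[of "- u"] by (simp add: gap_def \<psi>_0)
    also have "\<dots> \<le> \<bar>L\<bar> * norm u / 2" by (simp add: mult_right_mono)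
    finally show ?thesis by simp
  qed
  have bdd: "\<exists>B. \<forall>v. norm v \<le> 1 \<longrightarrow> \<bar>F (x + v)\<bar> \<le> B" for x
  proof (intro exI allI impI)
    fix v :: 'a assume v: "norm v \<le> 1"
    define \<rho> where "\<rho> = norm (x - e0) + 1"
    have n: "norm (x + v - e0) \<le> \<rho>" using norm_triangle_ineq[of "x - e0" v] v by (simp add: \<rho>_def algebra_simps)
    have 1: "\<bar>G e0 (x + v - e0)\<bar> \<le> norm (G e0) * \<rho>"
      using norm_blinfun[of "G e0" "x + v - e0"] mult_left_mono[OF n norm_ge_zero[of "G e0"]] by simp
    have 2: "\<psi> (x + v - e0) \<le> \<bar>L\<bar> * \<rho>"
      using \<psi>_le[of "x + v - e0"] mult_left_mono[OF n abs_ge_zero[of L]] by linarith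
    show "\<bar>F (x + v)\<bar> \<le> \<bar>f e0\<bar> + norm (G e0) * \<rho> + \<bar>L\<bar> * \<rho>"
      using hF[OF e0, of "x + v", unfolded h_def] Fg[OF e0, of "x + v", unfolded g_def] 1 2 by linarith
  qed
  have "F \<in> lipschitz_C1plus" by (rule small_gap_imp_C1[OF F \<theta>_lip \<theta>_small bdd])
  moreover have "F x = f x" if "x \<in> E" for x
    using hF[OF that, of x] Fg[OF that, of x] by (simp add: g_def h_def \<psi>_0)
  ultimately show ?thesis by blast
qed

section \<open>Jets of smooth functions on quasiconvex sets\<close>
lemma sum_lessThan_add: "(\<Sum>i<j + l. a i) = (\<Sum>i<j. a i) + (\<Sum>i<l. a (j + i) :: 'a::comm_monoid_add)" for j l :: nat
  by (induction l) (simp_all add: add.assoc)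

lemma dist_le_sum_steps: "j \<le> n \<Longrightarrow> dist (p 0) (p j) \<le> (\<Sum>i<n. dist (p i) (p (Suc i)))"
  for p :: "nat \<Rightarrow> 'a::metric_space"
proof -
  assume "j \<le> n"
  have "dist (p 0) (p j) \<le> (\<Sum>i<j. dist (p i) (p (Suc i)))"
  proof (induction j)
    case (Suc j)
    then show ?case using dist_triangle[of "p 0" "p (Suc j)" "p j"] by simp
  qed simp
  also have "\<dots> \<le> (\<Sum>i<n. dist (p i) (p (Suc i)))"
    using \<open>j \<le> n\<close> by (intro sum_mono2) auto
  finally show ?thesis .
qed

text \<open>The number of steps is not bounded, only their total length.  So the chain is cut greedily where it
  first leaves the \<open>\<delta>\<close>-ball around its start: each such piece has length more than \<open>\<delta>\<close> and contributes at
  most 2, once up to the last point inside and once for the step across.\<close>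
lemma chain_oscillation:
  fixes p :: "nat \<Rightarrow> 'a::metric_space" and D :: "'a \<Rightarrow> 'b::real_normed_vector"
  assumes \<delta>: "0 < \<delta>" and D: "\<And>x y. x \<in> U \<Longrightarrow> y \<in> U \<Longrightarrow> dist x y \<le> \<delta> \<Longrightarrow> norm (D x - D y) \<le> 1"
    and "\<And>i. i \<le> n \<Longrightarrow> p i \<in> U" and "\<And>i. i < n \<Longrightarrow> dist (p i) (p (Suc i)) \<le> \<delta>"
  shows "norm (D (p n) - D (p 0)) \<le> 1 + 2 / \<delta> * (\<Sum>i<n. dist (p i) (p (Suc i)))"
  using assms(3,4)
proof (induction n arbitrary: p rule: less_induct)
  case (less n)
  show ?case
  proof (cases "dist (p 0) (p n) \<le> \<delta>")
    case True
    have "norm (D (p n) - D (p 0)) \<le> 1" using less.prems True by (intro D) (auto simp: dist_commute)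
    moreover have "0 \<le> 2 / \<delta> * (\<Sum>i<n. dist (p i) (p (Suc i)))"
      using \<delta> by (intro mult_nonneg_nonneg sum_nonneg) auto
    ultimately show ?thesis by linarith
  next
    case False
    define j where "j = (LEAST j. \<delta> < dist (p 0) (p j))"
    have j: "\<delta> < dist (p 0) (p j)" unfolding j_def using False by (rule LeastI[of _ n, OF not_le_imp_less])
    have jn: "j \<le> n" unfolding j_def using False by (rule Least_le[OF not_le_imp_less])
    have "j \<noteq> 0" using j \<delta> by (intro notI) simp
    then obtain m where m: "j = Suc m" using not0_implies_Suc by blast
    then have near: "dist (p 0) (p m) \<le> \<delta>" using not_less_Least[of m "\<lambda>j. \<delta> < dist (p 0) (p j)"] by (simp add: j_def)
    have step1: "norm (D (p m) - D (p 0)) \<le> 1" using near m jn less.prems by (intro D) (auto simp: dist_commute)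
    have step2: "norm (D (p j) - D (p m)) \<le> 1" using m jn less.prems by (intro D) (auto simp: dist_commute)
    obtain l where l: "n = j + l" using jn le_Suc_ex by blast
    have "norm (D (p (j + l)) - D (p (j + 0))) \<le> 1 + 2 / \<delta> * (\<Sum>i<l. dist (p (j + i)) (p (j + Suc i)))"
      by (rule less.IH) (use less.prems l m in auto)
    then have far: "norm (D (p n) - D (p j)) \<le> 1 + 2 / \<delta> * (\<Sum>i<l. dist (p (j + i)) (p (j + Suc i)))"
      by (simp only: l add_0_right)
    have one: "1 \<le> 1 / \<delta> * (\<Sum>i<j. dist (p i) (p (Suc i)))"
      using j dist_le_sum_steps[of j j p] \<delta> by (simp add: pos_le_divide_eq)
    have tri: "norm (D (p n) - D (p 0)) \<le> norm (D (p n) - D (p j)) + norm (D (p j) - D (p m)) + norm (D (p m) - D (p 0))"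
      using norm_triangle_ineq[of "D (p n) - D (p j)" "D (p j) - D (p m)"]
        norm_triangle_ineq[of "D (p n) - D (p m)" "D (p m) - D (p 0)"] by simp
    have "2 / \<delta> * (\<Sum>i<n. dist (p i) (p (Suc i)))
        = 2 * (1 / \<delta> * (\<Sum>i<j. dist (p i) (p (Suc i)))) + 2 / \<delta> * (\<Sum>i<l. dist (p (j + i)) (p (j + Suc i)))"
      unfolding l sum_lessThan_add by (simp only: distrib_left add_Suc_right mult.assoc[symmetric])
    then show ?thesis using step1 step2 far one tri by linarith
  qed
qed

lemma chain_taylor:
  fixes f :: "'a::real_normed_vector \<Rightarrow> real" and D :: "'a \<Rightarrow> 'a \<Rightarrow>\<^sub>L real"
  assumes f: "\<And>i q. i < n \<Longrightarrow> q \<in> closed_segment (p i) (p (Suc i)) \<Longrightarrow> (f has_derivative D q) (at q)"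
    and D: "\<And>i q. i < n \<Longrightarrow> q \<in> closed_segment (p i) (p (Suc i)) \<Longrightarrow> norm (D q - A) \<le> \<epsilon>"
  shows "\<bar>f (p n) - f (p 0) - A (p n - p 0)\<bar> \<le> \<epsilon> * (\<Sum>i<n. dist (p i) (p (Suc i)))"
proof -
  define u where "u q = f q - A q" for q
  have step: "\<bar>u (p (Suc i)) - u (p i)\<bar> \<le> \<epsilon> * dist (p i) (p (Suc i))" if i: "i < n" for i
  proof -
    have "norm (u (p (Suc i)) - u (p i)) \<le> \<epsilon> * norm (p (Suc i) - p i)"
    proof (rule differentiable_bound[of "closed_segment (p i) (p (Suc i))" u "\<lambda>q. blinfun_apply (D q - A)"])
      fix q assume q: "q \<in> closed_segment (p i) (p (Suc i))"
      show "(u has_derivative blinfun_apply (D q - A)) (at q within closed_segment (p i) (p (Suc i)))"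
        unfolding u_def blinfun.diff_left
        by (intro has_derivative_diff has_derivative_at_withinI[OF f[OF i q]] bounded_linear_imp_has_derivative
            blinfun.bounded_linear_right)
      show "onorm (blinfun_apply (D q - A)) \<le> \<epsilon>" using D[OF i q] by (simp add: norm_blinfun.rep_eq)
    qed auto
    then show ?thesis by (simp add: dist_norm norm_minus_commute)
  qed
  have "\<bar>u (p m) - u (p 0)\<bar> \<le> \<epsilon> * (\<Sum>i<m. dist (p i) (p (Suc i)))" if "m \<le> n" for m
    using that
  proof (induction m)
    case (Suc m)
    then have "\<bar>u (p m) - u (p 0)\<bar> \<le> \<epsilon> * (\<Sum>i<m. dist (p i) (p (Suc i)))" by simp
    moreover have "\<bar>u (p (Suc m)) - u (p m)\<bar> \<le> \<epsilon> * dist (p m) (p (Suc m))"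
      using Suc.prems by (intro step) simp
    ultimately show ?case by (simp add: distrib_left)
  qed simp
  from this[of n] show ?thesis by (simp add: u_def blinfun.diff_right algebra_simps)
qed

definition fine_polygon :: "'a::real_normed_vector set \<Rightarrow> real \<Rightarrow> real \<Rightarrow> 'a \<Rightarrow> 'a \<Rightarrow> nat \<Rightarrow> (nat \<Rightarrow> 'a) \<Rightarrow> bool"
  where "fine_polygon U \<eta> l x y n p \<longleftrightarrow> p 0 = x \<and> p n = y \<and> (\<forall>i\<le>n. p i \<in> U) \<and>
    (\<forall>i<n. dist (p i) (p (Suc i)) \<le> \<eta>) \<and> (\<forall>i<n. closed_segment (p i) (p (Suc i)) \<subseteq> U) \<and>
    (\<Sum>i<n. dist (p i) (p (Suc i))) \<le> l"

lemma fine_polygonD: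
  assumes "fine_polygon U \<eta> l x y n p"
  shows "p 0 = x" "p n = y" "\<And>i. i \<le> n \<Longrightarrow> p i \<in> U"
    "\<And>i. i < n \<Longrightarrow> dist (p i) (p (Suc i)) \<le> \<eta>" "\<And>i. i < n \<Longrightarrow> closed_segment (p i) (p (Suc i)) \<subseteq> U"
    "(\<Sum>i<n. dist (p i) (p (Suc i))) \<le> l"
  using assms by (simp_all add: fine_polygon_def)

text \<open>A curve of length at most \<open>c * dist x y\<close> is compact in the open set, so that a sufficiently fine
  inscribed polygon stays inside as well.\<close>
lemma quasiconvex_fine_polygon:
  fixes U :: "'a::real_normed_vector set"
  assumes U: "open U" and qc: "c_quasiconvex c U" "1 \<le> c" and x: "x \<in> U" and y: "y \<in> U" and \<eta>: "0 < \<eta>"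
  obtains n p where "fine_polygon U \<eta> (c * dist x y) x y n p"
proof -
  obtain \<gamma> where \<gamma>: "path \<gamma>" "path_image \<gamma> \<subseteq> U" "\<gamma> 0 = x" "\<gamma> 1 = y"
    and len: "curve_length \<gamma> \<le> ennreal (c * dist x y)"
    using qc x y unfolding c_quasiconvex_def pathstart_def pathfinish_def by blast
  obtain e where e: "0 < e" "(\<Union>q\<in>path_image \<gamma>. ball q e) \<subseteq> U"
    using compact_subset_open_imp_ball_epsilon_subset[OF compact_path_image[OF \<gamma>(1)] U \<gamma>(2)] by blast
  have "uniformly_continuous_on {0..1} \<gamma>"
    using \<gamma>(1) unfolding path_def by (intro compact_uniformly_continuous) auto
  moreover have "0 < min \<eta> e" using \<eta> e(1) by simp
  ultimately obtain d where d: "0 < d"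
    and \<gamma>d: "\<And>s t. s \<in> {0..1} \<Longrightarrow> t \<in> {0..1} \<Longrightarrow> dist t s < d \<Longrightarrow> dist (\<gamma> t) (\<gamma> s) < min \<eta> e"
    unfolding uniformly_continuous_on_def by blast
  obtain m where m: "inverse (real (Suc m)) < d" using reals_Archimedean[OF d] by blast
  define n where "n = Suc m"
  have n0: "0 < real n" by (simp add: n_def)
  define \<tau> where "\<tau> i = real i / real n" for i
  have \<tau>: "\<tau> i \<in> {0..1}" if "i \<le> n" for i using that n0 by (simp add: \<tau>_def)
  have \<tau>_step: "dist (\<tau> i) (\<tau> (Suc i)) < d" for i
  proof -
    have "\<tau> (Suc i) - \<tau> i = inverse (real n)" using n0 by (simp add: \<tau>_def field_simps)
    moreover have "inverse (real n) < d" using m by (simp add: n_def)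
    moreover have "0 < inverse (real n)" using n0 by simp
    ultimately show ?thesis unfolding dist_real_def by linarith
  qed
  define p where "p i = \<gamma> (\<tau> i)" for i
  have pim: "p i \<in> path_image \<gamma>" if "i \<le> n" for i using \<tau>[OF that] by (auto simp: p_def path_image_def)
  have step: "dist (p i) (p (Suc i)) < min \<eta> e" if "i < n" for i
    unfolding p_def using that by (intro \<gamma>d \<tau> \<tau>_step) auto
  have "p 0 = x" "p n = y" using n0 by (auto simp: p_def \<tau>_def \<gamma>)
  moreover have "p i \<in> U" if "i \<le> n" for i using pim[OF that] \<gamma>(2) by blast
  moreover have "dist (p i) (p (Suc i)) \<le> \<eta>" if "i < n" for i using step[OF that] by simp
  moreover have "closed_segment (p i) (p (Suc i)) \<subseteq> U" if "i < n" for i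
  proof -
    have "closed_segment (p i) (p (Suc i)) \<subseteq> ball (p i) e"
      using step[OF that] e by (intro closed_segment_subset) auto
    moreover have "ball (p i) e \<subseteq> U" using pim[of i] e(2) that by (meson UN_subset_iff less_imp_le)
    ultimately show ?thesis by (rule order_trans)
  qed
  moreover have "(\<Sum>i<n. dist (p i) (p (Suc i))) \<le> c * dist x y"
  proof -
    have "mono_on {..n} \<tau>" using n0 by (intro mono_onI) (simp add: \<tau>_def divide_right_mono)
    moreover have "\<tau> ` {..n} \<subseteq> {0..1}" using \<tau> by blast
    ultimately have "ennreal (\<Sum>i<n. dist (p i) (p (Suc i))) \<le> curve_length \<gamma>"
      unfolding curve_length_def p_def by (intro SUP_upper2[of "(n, \<tau>)"]) simp_all
    also note len
    finally show ?thesis using qc(2) by (subst (asm) ennreal_le_iff) auto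
  qed
  ultimately have "fine_polygon U \<eta> (c * dist x y) x y n p" unfolding fine_polygon_def by (intro conjI allI impI)
  then show ?thesis by (rule that)
qed

text \<open>All points of a polygon of length at most \<open>c * dist x y\<close> from \<open>y\<close> to \<open>x\<close> are within \<open>c * dist x y\<close>
  of \<open>y\<close>, up to the mesh.  Hence the mean value theorem along the polygon bounds the Taylor remainder by the
  oscillation of \<open>D\<close> around \<open>y\<close> on that scale.  At small scales the oscillation is small by uniform
  continuity; at bounded scales it is bounded, by \<open>chain_oscillation\<close> along such a polygon.\<close>
lemma quasiconvex_jet_estimates:
  fixes f :: "'a::real_normed_vector \<Rightarrow> real" and D :: "'a \<Rightarrow> 'a \<Rightarrow>\<^sub>L real"
  assumes U: "open U" and qc: "c_quasiconvex c U" "1 \<le> c"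
    and f: "\<And>x. x \<in> U \<Longrightarrow> (f has_derivative D x) (at x)" and D: "uniformly_continuous_on U D"
  shows "\<exists>K. \<forall>x\<in>U. \<forall>y\<in>U. dist x y \<le> M \<longrightarrow>
      norm (D x - D y) \<le> K \<and> \<bar>f x - f y - D y (x - y)\<bar> \<le> K * norm (x - y)"
    and "0 < \<epsilon> \<Longrightarrow> \<exists>\<delta>>0. \<forall>x\<in>U. \<forall>y\<in>U. dist x y \<le> \<delta> \<longrightarrow>
      norm (D x - D y) \<le> \<epsilon> \<and> \<bar>f x - f y - D y (x - y)\<bar> \<le> \<epsilon> * norm (x - y)"
proof -
  have taylor: "\<bar>f x - f y - D y (x - y)\<bar> \<le> \<epsilon> * (c * norm (x - y))"
    if x: "x \<in> U" and y: "y \<in> U" and R: "c * dist x y < R"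
      and \<epsilon>: "\<And>q. q \<in> U \<Longrightarrow> dist q y \<le> R \<Longrightarrow> norm (D q - D y) \<le> \<epsilon>" for x y R \<epsilon>
  proof -
    have "0 < R - c * dist y x" using R unfolding dist_commute[of y x] by linarith
    note chain = quasiconvex_fine_polygon[OF U qc y x this]
    obtain n p where "fine_polygon U (R - c * dist y x) (c * dist y x) y x n p" by (rule chain)
    note p = fine_polygonD[OF this]
    have "0 \<le> dist x y" by simp
    then have "0 \<le> c * dist x y" using qc(2) by (intro mult_nonneg_nonneg) auto
    then have "dist y y \<le> R" using R by simp
    from \<epsilon>[OF y this] have \<epsilon>0: "0 \<le> \<epsilon>" by simp
    have "\<bar>f (p n) - f (p 0) - D y (p n - p 0)\<bar> \<le> \<epsilon> * (\<Sum>i<n. dist (p i) (p (Suc i)))"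
    proof (rule chain_taylor[where p = p and n = n])
      fix i q assume i: "i < n" and q: "q \<in> closed_segment (p i) (p (Suc i))"
      have qU: "q \<in> U" by (rule subsetD[OF p(5)[OF i] q])
      then show "(f has_derivative D q) (at q)" by (rule f)
      have "closed_segment (p i) (p (Suc i)) \<subseteq> cball (p i) (dist (p i) (p (Suc i)))"
        by (intro closed_segment_subset) auto
      then have "dist q (p i) \<le> dist (p i) (p (Suc i))" 
        using q unfolding subset_iff mem_cball dist_commute[of q "p i"] by blast
      moreover have "dist (p 0) (p i) \<le> c * dist y x"
        using dist_le_sum_steps[of i n p] i p(6) by linarith
      ultimately have "dist q y \<le> R"
        using dist_triangle[of q y "p i"] p(4)[OF i] dist_commute[of "p i" y] unfolding p(1) by linarith
      then show "norm (D q - D y) \<le> \<epsilon>" by (rule \<epsilon>[OF qU])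
    qed
    also have "\<dots> \<le> \<epsilon> * (c * dist y x)" using p(6) \<epsilon>0 by (rule mult_left_mono)
    finally show ?thesis unfolding p(1,2) dist_norm norm_minus_commute[of y x] .
  qed
  have D_uc: "\<exists>\<delta>>0. \<forall>x\<in>U. \<forall>y\<in>U. dist x y < \<delta> \<longrightarrow> norm (D x - D y) < \<epsilon>" if \<epsilon>: "0 < \<epsilon>" for \<epsilon>
  proof -
    obtain \<delta> where "0 < \<delta>" "\<forall>x\<in>U. \<forall>y\<in>U. dist y x < \<delta> \<longrightarrow> dist (D y) (D x) < \<epsilon>"
      using D \<epsilon> unfolding uniformly_continuous_on_def by blast
    then have "norm (D x - D y) < \<epsilon>" if "x \<in> U" "y \<in> U" "dist x y < \<delta>" for x y
      using that unfolding dist_norm[of "D x" "D y", symmetric] by blast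
    then show ?thesis using \<open>0 < \<delta>\<close> by blast
  qed
  obtain \<delta>1 where \<delta>1: "0 < \<delta>1" "\<And>x y. x \<in> U \<Longrightarrow> y \<in> U \<Longrightarrow> dist x y < \<delta>1 \<Longrightarrow> norm (D x - D y) < 1"
    using D_uc[of 1] zero_less_one by blast
  have osc: "norm (D x - D y) \<le> 1 + 4 / \<delta>1 * (c * dist x y)" if x: "x \<in> U" and y: "y \<in> U" for x y
  proof -
    have h: "0 < \<delta>1 / 2" using \<delta>1 by simp
    note chain = quasiconvex_fine_polygon[OF U qc y x this]
    obtain n p where "fine_polygon U (\<delta>1 / 2) (c * dist y x) y x n p" by (rule chain)
    note p = fine_polygonD[OF this]
    have "norm (D (p n) - D (p 0)) \<le> 1 + 2 / (\<delta>1 / 2) * (\<Sum>i<n. dist (p i) (p (Suc i)))"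
    proof (rule chain_oscillation[where p = p and n = n and U = U, OF h _ p(3,4)])
      fix x y assume "x \<in> U" "y \<in> U" "dist x y \<le> \<delta>1 / 2"
      then show "norm (D x - D y) \<le> 1" using \<delta>1 by (intro less_imp_le \<delta>1(2)) auto
    qed
    also have "\<dots> \<le> 1 + 2 / (\<delta>1 / 2) * (c * dist y x)"
      using p(6) \<delta>1 by (intro add_left_mono mult_left_mono) auto
    finally show ?thesis using \<delta>1(1) unfolding p(1,2) dist_commute[of y x] by simp
  qed
  show "\<exists>K. \<forall>x\<in>U. \<forall>y\<in>U. dist x y \<le> M \<longrightarrow>
      norm (D x - D y) \<le> K \<and> \<bar>f x - f y - D y (x - y)\<bar> \<le> K * norm (x - y)"
  proof (cases "M < 0")
    case True
    then have "\<not> dist x y \<le> M" for x y :: 'a using zero_le_dist[of x y] by linarith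
    then show ?thesis by blast
  next
    case False
    define R where "R = c * M + 1"
    define K where "K = 1 + 4 / \<delta>1 * (c * R)"
    have c0: "0 < c" using qc(2) by simp
    have "0 < R" using False c0 by (simp add: R_def add_nonneg_pos)
    have K: "0 \<le> K" using \<delta>1 c0 \<open>0 < R\<close> by (simp add: K_def)
    have oscR: "norm (D x - D y) \<le> K" if "x \<in> U" "y \<in> U" "dist x y \<le> R" for x y
    proof -
      have "4 / \<delta>1 * (c * dist x y) \<le> 4 / \<delta>1 * (c * R)"
        using that \<delta>1 c0 by (intro mult_left_mono) auto
      then show ?thesis using osc[OF that(1,2)] by (simp add: K_def)
    qed
    show ?thesis
    proof (intro exI[of _ "K * c"] ballI impI conjI)
      fix x y assume xy: "x \<in> U" "y \<in> U" "dist x y \<le> M"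
      have cM: "c * dist x y \<le> c * M" using xy c0 by simp
      moreover have "dist x y \<le> c * dist x y" using qc(2) mult_right_mono[of 1 c "dist x y"] by simp
      ultimately have "norm (D x - D y) \<le> K" using xy by (intro oscR) (auto simp: R_def)
      also have "K \<le> K * c" using K qc(2) by (simp add: mult_le_cancel_left1)
      finally show "norm (D x - D y) \<le> K * c" .
      have "\<bar>f x - f y - D y (x - y)\<bar> \<le> K * (c * norm (x - y))"
        using xy cM by (intro taylor[where R = R] oscR) (auto simp: R_def)
      then show "\<bar>f x - f y - D y (x - y)\<bar> \<le> K * c * norm (x - y)" by (simp only: mult.assoc)
    qed
  qed
  assume \<epsilon>: "0 < \<epsilon>"
  have c0: "0 < c" using qc(2) by simp
  then have "0 < \<epsilon> / c" using \<epsilon> by simp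
  then obtain \<delta> where \<delta>: "0 < \<delta>" "\<And>x y. x \<in> U \<Longrightarrow> y \<in> U \<Longrightarrow> dist x y < \<delta> \<Longrightarrow> norm (D x - D y) < \<epsilon> / c"
    using D_uc[of "\<epsilon> / c"] by blast
  show "\<exists>\<delta>>0. \<forall>x\<in>U. \<forall>y\<in>U. dist x y \<le> \<delta> \<longrightarrow>
      norm (D x - D y) \<le> \<epsilon> \<and> \<bar>f x - f y - D y (x - y)\<bar> \<le> \<epsilon> * norm (x - y)"
  proof (intro exI[of _ "\<delta> / (4 * c)"] ballI impI conjI)
    show "0 < \<delta> / (4 * c)" using \<delta> c0 by simp
    fix x y assume xy: "x \<in> U" "y \<in> U" "dist x y \<le> \<delta> / (4 * c)"
    have "c * dist x y \<le> \<delta> / 4" using xy c0 by (simp add: field_simps)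
    moreover have "dist x y \<le> c * dist x y" using qc(2) mult_right_mono[of 1 c "dist x y"] by simp
    ultimately have near: "c * dist x y < \<delta> / 2" "dist x y < \<delta>" using \<delta> by auto
    have "norm (D x - D y) < \<epsilon> / c" using xy near by (intro \<delta>(2))
    also have "\<epsilon> / c \<le> \<epsilon>" using \<epsilon> qc(2) by (simp add: divide_le_eq)
    finally show "norm (D x - D y) \<le> \<epsilon>" by simp
    have "\<bar>f x - f y - D y (x - y)\<bar> \<le> \<epsilon> / c * (c * norm (x - y))"
      using xy near \<delta> by (intro taylor[where R = "\<delta> / 2"] less_imp_le[OF \<delta>(2)]) auto
    then show "\<bar>f x - f y - D y (x - y)\<bar> \<le> \<epsilon> * norm (x - y)" using c0 by simp
  qed
qed

section \<open>Gluing with a smooth partition of unity\<close>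
lemma C1plusB_UNIVI:
  assumes "\<And>x. (F has_derivative blinfun_apply (D x)) (at x)"
    and "\<And>B. bounded B \<Longrightarrow> uniformly_continuous_on B D"
  shows "F \<in> C1plusB UNIV"
  unfolding C1plusB_def using assms by (intro CollectI exI[of _ D]) simp

lemma lipschitz_C1plus_diff:
  assumes "f \<in> lipschitz_C1plus" "g \<in> lipschitz_C1plus"
  shows "(\<lambda>x. f x - g x) \<in> lipschitz_C1plus"
proof -
  obtain Df Dg where f: "\<And>x. (f has_derivative blinfun_apply (Df x)) (at x)" "uniformly_continuous_on UNIV Df" "bounded (range Df)"
    and g: "\<And>x. (g has_derivative blinfun_apply (Dg x)) (at x)" "uniformly_continuous_on UNIV Dg" "bounded (range Dg)"
    using assms unfolding lipschitz_C1plus_def by blast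
  have "((\<lambda>x. f x - g x) has_derivative blinfun_apply (Df x - Dg x)) (at x)" for x
    unfolding blinfun.diff_left by (intro has_derivative_diff f g)
  moreover have "uniformly_continuous_on UNIV (\<lambda>x. Df x - Dg x)"
    by (intro uniformly_continuous_on_diff f g)
  moreover have "bounded (range (\<lambda>x. Df x - Dg x))" by (intro bounded_minus_comp f g)
  ultimately show ?thesis by (rule lipschitz_C1plusI)
qed

lemma uniformly_continuous_on_restrict:
  fixes f :: "'a::metric_space \<Rightarrow> 'b::metric_space"
  assumes f: "uniformly_continuous_on T f" and "S \<subseteq> T"
  shows "uniformly_continuous_on S f"
  unfolding uniformly_continuous_on_def
proof (intro allI impI)
  fix e :: real assume "0 < e"
  then obtain d where "0 < d" "\<forall>x\<in>T. \<forall>x'\<in>T. dist x' x < d \<longrightarrow> dist (f x') (f x) < e"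
    using f unfolding uniformly_continuous_on_def by blast
  with \<open>S \<subseteq> T\<close> show "\<exists>d>0. \<forall>x\<in>S. \<forall>x'\<in>S. dist x' x < d \<longrightarrow> dist (f x') (f x) < e"
    by (intro exI[of _ d]) auto
qed

lemma uniformly_continuous_on_scaleR_bounded:
  fixes f :: "'a::metric_space \<Rightarrow> real" and g :: "'a \<Rightarrow> 'b::real_normed_vector"
  assumes f: "uniformly_continuous_on S f" and fb: "\<And>x. x \<in> S \<Longrightarrow> \<bar>f x\<bar> \<le> M"
    and g: "uniformly_continuous_on S g" and gb: "\<And>x. x \<in> S \<Longrightarrow> norm (g x) \<le> M"
  shows "uniformly_continuous_on S (\<lambda>x. f x *\<^sub>R g x)"
  unfolding uniformly_continuous_on_def
proof (intro allI impI)
  fix e :: real assume e: "0 < e"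
  define \<epsilon> where "\<epsilon> = e / (2 * (\<bar>M\<bar> + 1))"
  have \<epsilon>: "0 < \<epsilon>" using e by (simp add: \<epsilon>_def)
  obtain d1 where d1: "0 < d1" "\<forall>x\<in>S. \<forall>y\<in>S. dist y x < d1 \<longrightarrow> dist (f y) (f x) < \<epsilon>"
    using f \<epsilon> unfolding uniformly_continuous_on_def by blast
  obtain d2 where d2: "0 < d2" "\<forall>x\<in>S. \<forall>y\<in>S. dist y x < d2 \<longrightarrow> dist (g y) (g x) < \<epsilon>"
    using g \<epsilon> unfolding uniformly_continuous_on_def by blast
  show "\<exists>d>0. \<forall>x\<in>S. \<forall>y\<in>S. dist y x < d \<longrightarrow> dist (f y *\<^sub>R g y) (f x *\<^sub>R g x) < e"
  proof (intro exI[of _ "min d1 d2"] conjI ballI impI)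
    show "0 < min d1 d2" using d1 d2 by simp
    fix x y assume xy: "x \<in> S" "y \<in> S" "dist y x < min d1 d2"
    have 1: "\<bar>f y - f x\<bar> < \<epsilon>" "norm (g y - g x) < \<epsilon>"
      using d1 d2 xy by (auto simp: dist_norm)
    have "f y *\<^sub>R g y - f x *\<^sub>R g x = f y *\<^sub>R (g y - g x) + (f y - f x) *\<^sub>R g x"
      by (simp add: algebra_simps)
    then have "dist (f y *\<^sub>R g y) (f x *\<^sub>R g x) \<le> \<bar>f y\<bar> * norm (g y - g x) + \<bar>f y - f x\<bar> * norm (g x)"
      using norm_triangle_ineq[of "f y *\<^sub>R (g y - g x)" "(f y - f x) *\<^sub>R g x"] by (simp add: dist_norm)
    also have "\<dots> \<le> \<bar>M\<bar> * \<epsilon> + \<epsilon> * \<bar>M\<bar>"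
      using 1 fb[OF xy(2)] gb[OF xy(1)] \<epsilon> by (intro add_mono mult_mono) auto
    also have "\<dots> < (2 * (\<bar>M\<bar> + 1)) * \<epsilon>" using \<epsilon> by (simp add: algebra_simps)
    also have "\<dots> = e" by (simp add: \<epsilon>_def)
    finally show "dist (f y *\<^sub>R g y) (f x *\<^sub>R g x) < e" .
  qed
qed

lemma bounded_derivative_imp_lipschitz:
  fixes u :: "'a::real_normed_vector \<Rightarrow> real"
  assumes u: "\<And>x. (u has_derivative blinfun_apply (Du x)) (at x)" and K: "\<And>x. norm (Du x) \<le> K"
  shows "\<bar>u x - u y\<bar> \<le> K * norm (x - y)"
proof -
  have "norm (u x - u y) \<le> K * norm (x - y)"
  proof (rule differentiable_bound[where S = UNIV and f = u and f' = "\<lambda>x. blinfun_apply (Du x)"])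
    show "(u has_derivative blinfun_apply (Du z)) (at z within UNIV)" for z by (rule u)
    show "onorm (blinfun_apply (Du z)) \<le> K" for z unfolding norm_blinfun.rep_eq[symmetric] by (rule K)
  qed (rule convex_UNIV UNIV_I)+
  then show ?thesis unfolding real_norm_def .
qed

text \<open>Only on bounded sets: the derivative \<open>f * Dg + g * Df\<close> contains the functions themselves, which may be
  unbounded.\<close>
lemma lipschitz_C1plus_mult:
  fixes f g :: "'a::real_normed_vector \<Rightarrow> real"
  assumes "f \<in> lipschitz_C1plus" "g \<in> lipschitz_C1plus"
  shows "(\<lambda>x. f x * g x) \<in> C1plusB UNIV"
proof -
  obtain Df Dg where f: "\<And>x. (f has_derivative blinfun_apply (Df x)) (at x)" "uniformly_continuous_on UNIV Df" "bounded (range Df)"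
    and g: "\<And>x. (g has_derivative blinfun_apply (Dg x)) (at x)" "uniformly_continuous_on UNIV Dg" "bounded (range Dg)"
    using assms unfolding lipschitz_C1plus_def by blast
  have lip: "\<exists>K. \<forall>x y. \<bar>u x - u y\<bar> \<le> K * norm (x - y)"
    if u: "\<And>x. (u has_derivative blinfun_apply (Du x)) (at x)" and b: "bounded (range Du)"
    for u :: "'a \<Rightarrow> real" and Du
  proof -
    obtain K where "\<forall>v\<in>range Du. norm v \<le> K" using b unfolding bounded_iff by blast
    then have K: "norm (Du x) \<le> K" for x by blast
    show ?thesis
      by (rule exI[of _ K], intro allI bounded_derivative_imp_lipschitz[of u Du] u K)
  qed
  have uc: "uniformly_continuous_on B u" and bd: "bounded (u ` B)"
    if K: "\<And>x y. \<bar>u x - u y\<bar> \<le> K * norm (x - y)" and B: "bounded B"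
    for u :: "'a \<Rightarrow> real" and K B
  proof -
    have "K \<le> \<bar>K\<bar> + 1" by simp
    then have K': "\<bar>u x - u y\<bar> \<le> (\<bar>K\<bar> + 1) * norm (x - y)" for x y
      using K[of x y] mult_right_mono[OF \<open>K \<le> \<bar>K\<bar> + 1\<close> norm_ge_zero[of "x - y"]] by linarith
    show "uniformly_continuous_on B u"
      unfolding uniformly_continuous_on_def
    proof (intro allI impI)
      fix e :: real assume e: "0 < e"
      show "\<exists>d>0. \<forall>x\<in>B. \<forall>x'\<in>B. dist x' x < d \<longrightarrow> dist (u x') (u x) < e"
      proof (intro exI[of _ "e / (\<bar>K\<bar> + 1)"] conjI ballI impI)
        show "0 < e / (\<bar>K\<bar> + 1)" using e by simp
        fix x x' :: 'a assume "dist x' x < e / (\<bar>K\<bar> + 1)"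
        then have "(\<bar>K\<bar> + 1) * norm (x' - x) < e"
          unfolding dist_norm by (subst (asm) pos_less_divide_eq) (simp_all add: mult.commute)
        then show "dist (u x') (u x) < e" using K'[of x' x] unfolding dist_real_def by linarith
      qed
    qed
    obtain R where R: "\<And>x. x \<in> B \<Longrightarrow> norm x \<le> R" using B unfolding bounded_iff by blast
    show "bounded (u ` B)"
    proof (rule boundedI)
      fix v assume "v \<in> u ` B"
      then obtain x where x: "x \<in> B" "v = u x" by blast
      have "(\<bar>K\<bar> + 1) * norm x \<le> (\<bar>K\<bar> + 1) * R" using R[OF x(1)] by (intro mult_left_mono) auto
      then show "norm v \<le> \<bar>u 0\<bar> + (\<bar>K\<bar> + 1) * R" 
        using K'[of x 0] abs_triangle_ineq2[of "u x" "u 0"] unfolding x(2) real_norm_def diff_zero by linarith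
    qed
  qed
  have "\<exists>K. \<forall>x y. \<bar>f x - f y\<bar> \<le> K * norm (x - y)" by (rule lip[of f Df]) (rule f)+
  then obtain Kf where Kf: "\<forall>x y. \<bar>f x - f y\<bar> \<le> Kf * norm (x - y)" ..
  have "\<exists>K. \<forall>x y. \<bar>g x - g y\<bar> \<le> K * norm (x - y)" by (rule lip[of g Dg]) (rule g)+
  then obtain Kg where Kg: "\<forall>x y. \<bar>g x - g y\<bar> \<le> Kg * norm (x - y)" ..
  have prod_uc: "uniformly_continuous_on B (\<lambda>x. u x *\<^sub>R Dv x)"
    if K: "\<And>x y. \<bar>u x - u y\<bar> \<le> K * norm (x - y)" and B: "bounded B"
      and Dv: "uniformly_continuous_on UNIV Dv" "bounded (range Dv)"
    for u :: "'a \<Rightarrow> real" and K B and Dv :: "'a \<Rightarrow> 'a \<Rightarrow>\<^sub>L real"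
  proof -
    obtain M1 where "\<forall>v\<in>u ` B. norm v \<le> M1" using bd[of u K B, OF K B] unfolding bounded_iff ..
    then have M1: "\<bar>u x\<bar> \<le> M1" if "x \<in> B" for x using that by simp
    obtain M2 where "\<forall>v\<in>range Dv. norm v \<le> M2" using Dv(2) unfolding bounded_iff by blast
    then have M2: "norm (Dv x) \<le> M2" for x by simp
    show ?thesis
    proof (rule uniformly_continuous_on_scaleR_bounded[where M = "max M1 M2"])
      show "uniformly_continuous_on B u" by (rule uc[of u K B, OF K B])
      show "uniformly_continuous_on B Dv" 
        by (rule uniformly_continuous_on_restrict[OF Dv(1) subset_UNIV])
      show "\<bar>u x\<bar> \<le> max M1 M2" if "x \<in> B" for x using M1[OF that] by (simp add: le_max_iff_disj)
      show "norm (Dv x) \<le> max M1 M2" for x using M2[of x] by (simp add: le_max_iff_disj)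
    qed
  qed
  have "((\<lambda>x. f x * g x) has_derivative blinfun_apply (f x *\<^sub>R Dg x + g x *\<^sub>R Df x)) (at x)" for x
  proof -
    have "blinfun_apply (f x *\<^sub>R Dg x + g x *\<^sub>R Df x) = (\<lambda>h. f x * Dg x h + Df x h * g x)"
      by (simp add: fun_eq_iff blinfun.add_left blinfun.scaleR_left)
    then show ?thesis using has_derivative_mult[OF f(1)[of x] g(1)[of x]] by (simp only:)
  qed
  moreover have "uniformly_continuous_on B (\<lambda>x. f x *\<^sub>R Dg x + g x *\<^sub>R Df x)" if B: "bounded B" for B
  proof (rule uniformly_continuous_on_add)
    show "uniformly_continuous_on B (\<lambda>x. f x *\<^sub>R Dg x)"
      by (rule prod_uc[of f Kf B Dg, OF Kf[rule_format] B g(2,3)])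
    show "uniformly_continuous_on B (\<lambda>x. g x *\<^sub>R Df x)"
      by (rule prod_uc[of g Kg B Df, OF Kg[rule_format] B f(2,3)])
  qed
  ultimately show ?thesis by (rule C1plusB_UNIVI)
qed

lemma C1plusB_sum:
  assumes "\<And>i. i \<in> I \<Longrightarrow> f i \<in> C1plusB UNIV"
  shows "(\<lambda>x. \<Sum>i\<in>I. f i x) \<in> C1plusB UNIV"
proof -
  have "\<exists>D. \<forall>i\<in>I. (\<forall>x. (f i has_derivative blinfun_apply (D i x)) (at x)) \<and>
      (\<forall>B. bounded B \<longrightarrow> uniformly_continuous_on B (D i))"
    using assms unfolding C1plusB_def by (intro bchoice) auto
  then obtain D where D: "\<And>i x. i \<in> I \<Longrightarrow> (f i has_derivative blinfun_apply (D i x)) (at x)"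
    "\<And>i B. i \<in> I \<Longrightarrow> bounded B \<Longrightarrow> uniformly_continuous_on B (D i)" by blast
  have "((\<lambda>x. \<Sum>i\<in>I. f i x) has_derivative blinfun_apply (\<Sum>i\<in>I. D i x)) (at x)" for x
    unfolding blinfun.sum_left by (intro has_derivative_sum D)
  moreover have "uniformly_continuous_on B (\<lambda>x. \<Sum>i\<in>I. D i x)" if "bounded B" for B
    by (intro uniformly_continuous_on_sum D that)
  ultimately show ?thesis by (rule C1plusB_UNIVI)
qed

text \<open>Membership in \<open>C1plusB UNIV\<close> is local on balls, since derivatives on nested balls agree by
  uniqueness.\<close>
lemma C1plusB_exhaustion:
  fixes F :: "'a::real_normed_vector \<Rightarrow> real"
  assumes S: "\<And>m::nat. S m \<in> C1plusB UNIV" and eq: "\<And>m x. norm x \<le> real m \<Longrightarrow> F x = S m x"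
  shows "F \<in> C1plusB UNIV"
proof -
  have "\<exists>D. \<forall>m. (\<forall>x. (S m has_derivative blinfun_apply (D m x)) (at x)) \<and>
      (\<forall>B. bounded B \<longrightarrow> uniformly_continuous_on B (D m))"
    using S unfolding C1plusB_def by (intro choice allI) simp
  then obtain D where D: "\<And>m x. (S m has_derivative blinfun_apply (D m x)) (at x)"
    "\<And>m B. bounded B \<Longrightarrow> uniformly_continuous_on B (D m)" by blast
  have der: "(F has_derivative blinfun_apply (D m x)) (at x)" if x: "norm x < real m" for m x
    by (rule has_derivative_transform_within_open[OF D(1), of "ball 0 (real m)"])
      (use x eq[of _ m] in auto)
  define k where "k x = nat \<lfloor>norm x\<rfloor> + 1" for x :: 'a
  have k: "norm x < real (k x)" for x unfolding k_def by linarith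
  define D' where "D' x = D (k x) x" for x
  have D'_eq: "D' x = D m x" if "norm x < real m" for m x
    using has_derivative_unique[OF der[OF k[of x]] der[OF that]]
    by (simp add: D'_def blinfun_apply_inject)
  have "(F has_derivative blinfun_apply (D' x)) (at x)" for x
    unfolding D'_def by (rule der[OF k])
  moreover have "uniformly_continuous_on B D'" if B: "bounded B" for B
  proof -
    obtain R where R: "\<And>x. x \<in> B \<Longrightarrow> norm x \<le> R" using B unfolding bounded_iff by blast
    obtain m :: nat where m: "R < real m" using reals_Archimedean2 by blast
    have "D' x = D m x" if "x \<in> B" for x using R[OF that] m by (intro D'_eq) simp
    then show ?thesis using D(2)[OF B, of m] unfolding uniformly_continuous_on_def by simp
  qed
  ultimately show ?thesis by (rule C1plusB_UNIVI)
qed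

text \<open>On the union of a ball and the complement of a larger one, a function that is 1 on the former and 0 on
  the latter, with derivative 0, is a Whitney jet: its remainders vanish at distances below 1.\<close>
lemma smooth_cutoff_exists:
  assumes sr: "super_reflexive TYPE('a::banach)"
  shows "\<exists>\<kappa> \<in> lipschitz_C1plus. (\<forall>x::'a. norm x \<le> r \<longrightarrow> \<kappa> x = 1) \<and> (\<forall>x. r + 1 \<le> norm x \<longrightarrow> \<kappa> x = 0)"
proof -
  define E where "E = {x::'a. norm x \<le> r \<or> r + 1 \<le> norm x}"
  define f where "f x = (if norm x \<le> r then 1 else 0 :: real)" for x :: 'a
  have sep: "f x = f y \<or> 1 \<le> norm (x - y)" if "x \<in> E" "y \<in> E" for x y
  proof (cases "norm x \<le> r \<longleftrightarrow> norm y \<le> r")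
    case False
    then have "1 \<le> \<bar>norm x - norm y\<bar>" using that unfolding E_def mem_Collect_eq by linarith
    then show ?thesis using norm_triangle_ineq3[of x y] by linarith
  qed (simp add: f_def)
  have f01: "\<bar>f x - f y\<bar> \<le> 1" for x y by (simp add: f_def)
  have "\<exists>F\<in>lipschitz_C1plus. \<forall>x\<in>E. F x = f x"
  proof (rule whitney_extension[OF sr, where G = "\<lambda>_. 0" and K = 1])
    fix x y assume xy: "x \<in> E" "y \<in> E"
    show "norm (0 - 0 :: 'a \<Rightarrow>\<^sub>L real) \<le> 1 \<and> \<bar>f x - f y - blinfun_apply 0 (x - y)\<bar> \<le> 1 * norm (x - y)"
      using sep[OF xy] f01[of x y] by auto
  next
    fix \<epsilon> :: real assume \<epsilon>: "0 < \<epsilon>"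
    have "\<bar>f x - f y - blinfun_apply 0 (x - y)\<bar> \<le> \<epsilon> * norm (x - y)"
      if "x \<in> E" "y \<in> E" "norm (x - y) \<le> 1 / 2" for x y
    proof -
      have "f x = f y" using sep[OF that(1,2)] that(3) by linarith
      then show ?thesis using \<epsilon> by simp
    qed
    then show "\<exists>\<delta>>0. \<forall>x\<in>E. \<forall>y\<in>E. norm (x - y) \<le> \<delta> \<longrightarrow>
      norm (0 - 0 :: 'a \<Rightarrow>\<^sub>L real) \<le> \<epsilon> \<and> \<bar>f x - f y - blinfun_apply 0 (x - y)\<bar> \<le> \<epsilon> * norm (x - y)"
      using \<epsilon> by (intro exI[of _ "1 / 2"]) simp
  qed
  then obtain F where F: "F \<in> lipschitz_C1plus" "\<And>x. x \<in> E \<Longrightarrow> F x = f x" by blast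
  note F(1)
  moreover have "F x = 1" if "norm x \<le> r" for x using F(2)[of x] that by (simp add: E_def f_def)
  moreover have "F x = 0" if "r + 1 \<le> norm x" for x using F(2)[of x] that by (simp add: E_def f_def)
  ultimately show ?thesis by blast
qed

theorem corollary62:
  fixes U :: "'a::banach set" and f :: "'a \<Rightarrow> real"
  assumes "super_reflexive TYPE('a)"
    and "open U" and "quasiconvex U"
    and "f \<in> C1plus U"
  shows "\<exists>F \<in> C1plusB (UNIV :: 'a set). \<forall>x\<in>U. F x = f x"
proof -
  obtain c where qc: "c_quasiconvex c U" "1 \<le> c" using assms(3) unfolding quasiconvex_def by blast
  obtain D where D: "\<And>x. x \<in> U \<Longrightarrow> (f has_derivative blinfun_apply (D x)) (at x)"
    "uniformly_continuous_on U D" using assms(4) unfolding C1plus_def by blast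
  have "\<exists>F\<in>lipschitz_C1plus. \<forall>x\<in>U. norm x \<le> real n + 1 \<longrightarrow> F x = f x" for n :: nat
  proof -
    define E where "E = {x\<in>U. norm x \<le> real n + 1}"
    obtain K where K: "\<forall>x\<in>U. \<forall>y\<in>U. dist x y \<le> 2 * (real n + 1) \<longrightarrow>
      norm (D x - D y) \<le> K \<and> \<bar>f x - f y - D y (x - y)\<bar> \<le> K * norm (x - y)"
      using quasiconvex_jet_estimates(1)[OF assms(2) qc D] by blast
    have "\<exists>F\<in>lipschitz_C1plus. \<forall>x\<in>E. F x = f x"
    proof (rule whitney_extension[OF assms(1), where G = D and K = K])
      fix x y assume xy: "x \<in> E" "y \<in> E"
      then have "dist x y \<le> 2 * (real n + 1)"
        using norm_triangle_ineq4[of x y] by (simp add: E_def dist_norm)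
      then show "norm (D x - D y) \<le> K \<and> \<bar>f x - f y - D y (x - y)\<bar> \<le> K * norm (x - y)"
        using K xy by (simp add: E_def)
    next
      fix \<epsilon> :: real assume \<epsilon>: "0 < \<epsilon>"
      show "\<exists>\<delta>>0. \<forall>x\<in>E. \<forall>y\<in>E. norm (x - y) \<le> \<delta> \<longrightarrow>
          norm (D x - D y) \<le> \<epsilon> \<and> \<bar>f x - f y - D y (x - y)\<bar> \<le> \<epsilon> * norm (x - y)"
        using quasiconvex_jet_estimates(2)[OF assms(2) qc D \<epsilon>] unfolding dist_norm E_def by blast
    qed
    then show ?thesis unfolding E_def by blast
  qed
  then have "\<forall>n. \<exists>F. F \<in> lipschitz_C1plus \<and> (\<forall>x\<in>U. norm x \<le> real n + 1 \<longrightarrow> F x = f x)" by blast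
  from choice[OF this] obtain F where
    F': "\<forall>n. F n \<in> lipschitz_C1plus \<and> (\<forall>x\<in>U. norm x \<le> real n + 1 \<longrightarrow> F n x = f x)" ..
  have F: "F n \<in> lipschitz_C1plus" and F_eq: "x \<in> U \<Longrightarrow> norm x \<le> real n + 1 \<Longrightarrow> F n x = f x" for n x
    using F' by blast+
  have "\<forall>n. \<exists>\<kappa>. \<kappa> \<in> lipschitz_C1plus \<and> (\<forall>x::'a. norm x \<le> real n \<longrightarrow> \<kappa> x = 1) \<and>
      (\<forall>x. real n + 1 \<le> norm x \<longrightarrow> \<kappa> x = 0)"
    using smooth_cutoff_exists[OF assms(1)] by blast
  from choice[OF this] obtain \<kappa> where
    \<kappa>': "\<forall>n. \<kappa> n \<in> lipschitz_C1plus \<and> (\<forall>x::'a. norm x \<le> real n \<longrightarrow> \<kappa> n x = 1) \<and>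
      (\<forall>x. real n + 1 \<le> norm x \<longrightarrow> \<kappa> n x = 0)" ..
  have \<kappa>: "\<kappa> n \<in> lipschitz_C1plus" and \<kappa>1: "norm x \<le> real n \<Longrightarrow> \<kappa> n x = 1"
    and \<kappa>0: "real n + 1 \<le> norm x \<Longrightarrow> \<kappa> n x = 0" for n x
    using \<kappa>' by blast+
  \<comment> \<open>A telescoping partition of unity: \<open>w n\<close> lives in the shell \<open>n - 1 \<le> norm x \<le> n + 1\<close>, inside the
    ball on which \<open>F n\<close> is known to agree with \<open>f\<close>.\<close>
  define w where "w n = (case n of 0 \<Rightarrow> \<kappa> 0 | Suc k \<Rightarrow> \<lambda>x. \<kappa> (Suc k) x - \<kappa> k x)" for n
  have w: "w n \<in> lipschitz_C1plus" for n
    by (cases n) (simp_all add: w_def \<kappa> lipschitz_C1plus_diff)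
  have w_sum: "(\<Sum>n\<le>m. w n x) = \<kappa> m x" for m x
    by (induction m) (simp_all add: w_def)
  have w_far: "w n x = 0" if "real n + 1 \<le> norm x" for n x
    using that by (cases n) (simp_all add: w_def \<kappa>0)
  have w_near: "w n x = 0" if "norm x \<le> real m" "m < n" for m n x
    using that by (cases n) (simp_all add: w_def \<kappa>1)
  define S where "S m x = (\<Sum>n\<le>m. w n x * F n x)" for m x
  \<comment> \<open>The infinite sum of the \<open>w n * F n\<close>, cut off after its last possibly nonzero term at \<open>x\<close>.\<close>
  define G where "G x = S (nat \<lceil>norm x\<rceil>) x" for x
  have G_eq: "G x = S m x" if "norm x \<le> real m" for m x
  proof -
    have n: "norm x \<le> real (nat \<lceil>norm x\<rceil>)" by linarith
    have "nat \<lceil>norm x\<rceil> \<le> m" using that by (simp add: ceiling_le_iff nat_le_iff)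
    then show ?thesis
      unfolding G_def S_def by (intro sum.mono_neutral_left) (auto simp: w_near[OF n])
  qed
  have "S m \<in> C1plusB UNIV" for m
    unfolding S_def by (intro C1plusB_sum lipschitz_C1plus_mult w F)
  then have "G \<in> C1plusB UNIV" using G_eq by (rule C1plusB_exhaustion)
  moreover have "G x = f x" if x: "x \<in> U" for x
  proof -
    obtain m :: nat where m: "norm x \<le> real m" using real_arch_simple by blast
    have wF: "w n x * F n x = w n x * f x" for n
      using F_eq[OF x, of n] w_far[of n x] by (cases "norm x \<le> real n + 1") auto
    have "S m x = (\<Sum>n\<le>m. w n x) * f x" unfolding S_def wF sum_distrib_right ..
    then show ?thesis using G_eq[OF m] \<kappa>1[OF m] by (simp add: w_sum)
  qed
  ultimately show ?thesis by blast
qed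

end
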